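(* Let $X$ be a nonempty set and let $w$ be a quasi-modular gauge on $X$ with respect to a continuous $t$-conorm $\oplus$. Then the Cauchy completion of the symmetric $\mathsf W$-category $X_{w^{\mathrm{sym}}}$ coincides, up to unique bi-uniform isomorphism (compatible with the canonical maps from $X$), with the uniform completion of the symmetrized uniform space $\bigl(X,\mathcal U(w^{\mathrm{sym}})\bigr)$.
   Context: A $t$-conorm on $[0,1]$ is a commutative, associative, coordinatewise nondecreasing operation $\oplus:[0,1]^2\to[0,1]$ with $a\oplus 0=a$. A quasi-modular gauge on $X$ with respect to $\oplus$ is a map $w:X\times X\times(0,\infty)\to[0,1)$ such that for all $x,y,z\in X$ and $s,t>0$: (W1) $w(x,y,t)=0$ if and only if $x=y$ (and $w(x,y,t)<1$); (W3) $w(x,z,t+s)\le w(x,y,t)\oplus w(y,z,s)$; (W4) $t\mapsto w(x,y,t)$ is continuous and nonincreasing. Symmetry is not required. Symmetrization: $w^{\mathrm{sym}}(x,y,t):=w(x,y,t)\oplus w(y,x,t)$. For $r\in(0,1)$, $t>0$ put $E^+_{r,t}=\{(x,y):w(x,y,t)<r\}$, $E^-_{r,t}=\{(x,y):w(y,x,t)<r\}$ and $E^{\mathrm{sym}}_{r,t}=E^+_{r,t}\cap E^-_{r,t}$. $\mathcal U(w^{\mathrm{sym}})$ is the uniformity on $X$ generated by the sets $E^{\mathrm{sym}}_{r,t}$. The base $\mathsf W$: the complete lattice of all right-continuous nonincreasing functions $\varphi:(0,\infty)\to[0,1]$, ordered by $\varphi\preceq\psi$ iff $\varphi(t)\ge\psi(t)$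 for all $t$, with monoidal product $(\varphi\star\psi)(u):=\inf_{u=t+s}(\varphi(t)\oplus\psi(s))$ (infimum over $t,s>0$) and unit the constant function $\mathbf 0$; the paper regards $(\mathsf W,\preceq,\star,\mathbf 0)$ as a commutative unital quantale. A $\mathsf W$-category $C$ is a set of objects with hom-objects $C(a,b)\in\mathsf W$ such that $C(a,b)\star C(b,c)\preceq C(a,c)$ and $\mathbf 0\preceq C(a,a)$; it is symmetric if $C(a,b)=C(b,a)$. $X_{w^{\mathrm{sym}}}$ is the $\mathsf W$-category with object set $X$ and hom-objects $t\mapsto w^{\mathrm{sym}}(x,y,t)$. The Cauchy completion of a $\mathsf W$-category $C$ is, in the standard sense of enriched category theory (Kelly), the $\mathsf W$-category of Cauchy modules of $C$, i.e. the full sub-$\mathsf W$-category of the presheaf category on those modules that have a right adjoint in the bicategory of $\mathsf W$-modules, together with the Yoneda embedding of $C$. A $\mathsf W$-category $C$ is regarded as a uniform space via the uniformity generated by the sets $\{(a,b): C(a,b)(t)<r \text{ and } C(b,a)(t)<r\}$, $r\in(0,1)$, $t>0$. The uniform completion of a (separated) uniform space is a complete separated uniform space together with a uniform embedding with dense image. A bi-uniform isomorphism is a bijection that is uniformly continuous in both directions for these symmetric uniformities. *)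

theory Defs
  imports "HOL-Analysis.Analysis"
begin

section \<open>T-conorms and quasi-modular gauges\<close>

definition tconorm :: "(real \<Rightarrow> real \<Rightarrow> real) \<Rightarrow> bool" where
  "tconorm S \<longleftrightarrow>
     (\<forall>a\<in>{0..1}. \<forall>b\<in>{0..1}. S a b \<in> {0..1}) \<and>
     (\<forall>a\<in>{0..1}. \<forall>b\<in>{0..1}. S a b = S b a) \<and>
     (\<forall>a\<in>{0..1}. \<forall>b\<in>{0..1}. \<forall>c\<in>{0..1}. S (S a b) c = S a (S b c)) \<and>
     (\<forall>a\<in>{0..1}. \<forall>b\<in>{0..1}. \<forall>a'\<in>{0..1}. \<forall>b'\<in>{0..1}.
        a \<le> a' \<longrightarrow> b \<le> b' \<longrightarrow> S a b \<le> S a' b') \<and>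
     (\<forall>a\<in>{0..1}. S a 0 = a)"

definition continuous_tconorm :: "(real \<Rightarrow> real \<Rightarrow> real) \<Rightarrow> bool" where
  "continuous_tconorm S \<longleftrightarrow>
     tconorm S \<and> continuous_on ({0..1} \<times> {0..1}) (\<lambda>(a, b). S a b)"

definition quasi_modular_gauge ::
    "(real \<Rightarrow> real \<Rightarrow> real) \<Rightarrow> 'a set \<Rightarrow> ('a \<Rightarrow> 'a \<Rightarrow> real \<Rightarrow> real) \<Rightarrow> bool" where
  "quasi_modular_gauge S X w \<longleftrightarrow>
     (\<forall>x\<in>X. \<forall>y\<in>X. \<forall>t>0. w x y t \<in> {0..<1}) \<and>
     (\<forall>x\<in>X. \<forall>y\<in>X. \<forall>t>0. w x y t = 0 \<longleftrightarrow> x = y) \<and>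
     (\<forall>x\<in>X. \<forall>y\<in>X. \<forall>z\<in>X. \<forall>s>0. \<forall>t>0. w x z (t + s) \<le> S (w x y t) (w y z s)) \<and>
     (\<forall>x\<in>X. \<forall>y\<in>X. continuous_on {0<..} (w x y) \<and> antimono_on {0<..} (w x y))"

section \<open>Uniform spaces with an explicit carrier\<close>

text \<open>
  A uniformity on a set \<open>Y\<close> is given, as in the type class \<^class>\<open>uniform_space\<close>, by its
  filter of entourages on pairs; the carrier is explicit here.
\<close>

definition uniformity_carrier :: "'b set \<Rightarrow> ('b \<times> 'b) filter \<Rightarrow> bool" where
  "uniformity_carrier Y \<V> \<longleftrightarrow>
     \<V> \<le> principal (Y \<times> Y) \<and>
     (\<forall>E. eventually E \<V> \<longrightarrow> (\<forall>y\<in>Y. E (y, y))) \<and>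
     (\<forall>E. eventually E \<V> \<longrightarrow> eventually (\<lambda>(x, y). E (y, x)) \<V>) \<and>
     (\<forall>E. eventually E \<V> \<longrightarrow>
        (\<exists>D. eventually D \<V> \<and> (\<forall>x\<in>Y. \<forall>y\<in>Y. \<forall>z\<in>Y. D (x, y) \<longrightarrow> D (y, z) \<longrightarrow> E (x, z))))"

definition separated_uniformity :: "'b set \<Rightarrow> ('b \<times> 'b) filter \<Rightarrow> bool" where
  "separated_uniformity Y \<V> \<longleftrightarrow>
     (\<forall>x\<in>Y. \<forall>y\<in>Y. (\<forall>E. eventually E \<V> \<longrightarrow> E (x, y)) \<longrightarrow> x = y)"

text \<open>\<open>filterlim (Pair y) \<V> F\<close> says that \<open>F\<close> converges to \<open>y\<close>: it contains each \<open>{b. (y, b) \<in> E}\<close>.\<close>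

definition complete_uniformity :: "'b set \<Rightarrow> ('b \<times> 'b) filter \<Rightarrow> bool" where
  "complete_uniformity Y \<V> \<longleftrightarrow>
     (\<forall>F. F \<noteq> bot \<longrightarrow> F \<le> principal Y \<longrightarrow> F \<times>\<^sub>F F \<le> \<V> \<longrightarrow> (\<exists>y\<in>Y. filterlim (Pair y) \<V> F))"

definition uniformly_continuous_map ::
    "'b set \<Rightarrow> ('b \<times> 'b) filter \<Rightarrow> 'c set \<Rightarrow> ('c \<times> 'c) filter \<Rightarrow> ('b \<Rightarrow> 'c) \<Rightarrow> bool" where
  "uniformly_continuous_map Y \<V> Z \<W> f \<longleftrightarrow> f \<in> Y \<rightarrow> Z \<and> filterlim (map_prod f f) \<W> \<V>"

definition bi_uniform_iso ::
    "'b set \<Rightarrow> ('b \<times> 'b) filter \<Rightarrow> 'c set \<Rightarrow> ('c \<times> 'c) filter \<Rightarrow> ('b \<Rightarrow> 'c) \<Rightarrow> bool" where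
  "bi_uniform_iso Y \<V> Z \<W> h \<longleftrightarrow>
     bij_betw h Y Z \<and> uniformly_continuous_map Y \<V> Z \<W> h \<and>
     uniformly_continuous_map Z \<W> Y \<V> (inv_into Y h)"

definition uniform_embedding ::
    "'b set \<Rightarrow> ('b \<times> 'b) filter \<Rightarrow> 'c set \<Rightarrow> ('c \<times> 'c) filter \<Rightarrow> ('b \<Rightarrow> 'c) \<Rightarrow> bool" where
  "uniform_embedding Y \<V> Z \<W> j \<longleftrightarrow>
     j \<in> Y \<rightarrow> Z \<and> bi_uniform_iso Y \<V> (j ` Y) (inf \<W> (principal (j ` Y \<times> j ` Y))) j"

definition dense_image :: "'b set \<Rightarrow> 'c set \<Rightarrow> ('c \<times> 'c) filter \<Rightarrow> ('b \<Rightarrow> 'c) \<Rightarrow> bool" where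
  "dense_image Y Z \<W> j \<longleftrightarrow> (\<forall>z\<in>Z. \<forall>E. eventually E \<W> \<longrightarrow> (\<exists>y\<in>Y. E (z, j y)))"

definition uniform_completion ::
    "'b set \<Rightarrow> ('b \<times> 'b) filter \<Rightarrow> 'c set \<Rightarrow> ('c \<times> 'c) filter \<Rightarrow> ('b \<Rightarrow> 'c) \<Rightarrow> bool" where
  "uniform_completion X \<U> Y \<V> j \<longleftrightarrow>
     uniformity_carrier X \<U> \<and>
     uniformity_carrier Y \<V> \<and> separated_uniformity Y \<V> \<and> complete_uniformity Y \<V> \<and>
     uniform_embedding X \<U> Y \<V> j \<and> dense_image X Y \<V> j"

section \<open>The symmetrized uniformity of a gauge\<close>

definition E_plus :: "'a set \<Rightarrow> ('a \<Rightarrow> 'a \<Rightarrow> real \<Rightarrow> real) \<Rightarrow> real \<Rightarrow> real \<Rightarrow> ('a \<times> 'a) set" where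
  "E_plus X w r t = {(x, y). x \<in> X \<and> y \<in> X \<and> w x y t < r}"

definition E_minus :: "'a set \<Rightarrow> ('a \<Rightarrow> 'a \<Rightarrow> real \<Rightarrow> real) \<Rightarrow> real \<Rightarrow> real \<Rightarrow> ('a \<times> 'a) set" where
  "E_minus X w r t = {(x, y). x \<in> X \<and> y \<in> X \<and> w y x t < r}"

definition E_sym :: "'a set \<Rightarrow> ('a \<Rightarrow> 'a \<Rightarrow> real \<Rightarrow> real) \<Rightarrow> real \<Rightarrow> real \<Rightarrow> ('a \<times> 'a) set" where
  "E_sym X w r t = E_plus X w r t \<inter> E_minus X w r t"

definition sym_uniformity :: "'a set \<Rightarrow> ('a \<Rightarrow> 'a \<Rightarrow> real \<Rightarrow> real) \<Rightarrow> ('a \<times> 'a) filter" where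
  "sym_uniformity X w = (INF r\<in>{0<..<1}. INF t\<in>{0<..}. principal (E_sym X w r t))"

section \<open>The base of enrichment\<close>

text \<open>Functions on \<open>(0, \<infinity>)\<close> are represented by functions that are \<open>undefined\<close> off \<open>{0<..}\<close>.\<close>

definition W :: "(real \<Rightarrow> real) set" where
  "W = {\<phi> \<in> {0<..} \<rightarrow>\<^sub>E {0..1}. antimono_on {0<..} \<phi> \<and> (\<forall>t>0. continuous (at_right t) \<phi>)}"

text \<open>Note the reversal: the order of the base is opposite to the pointwise order.\<close>

definition wle :: "(real \<Rightarrow> real) \<Rightarrow> (real \<Rightarrow> real) \<Rightarrow> bool" (infix "\<preceq>" 50) where
  "\<phi> \<preceq> \<psi> \<longleftrightarrow> (\<forall>t>0. \<phi> t \<ge> \<psi> t)"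

definition wunit :: "real \<Rightarrow> real" where
  "wunit = (\<lambda>t\<in>{0<..}. 0)"

text \<open>
  The product of two members of \<^const>\<open>W\<close> is nonincreasing but need not be right-continuous (the
  product of \<^const>\<open>wunit\<close> with \<open>\<phi>\<close> is \<open>u \<mapsto> \<phi>(u-)\<close>), so it is a plain function. Below, products occur
  only in inequalities \<open>\<phi> \<star> \<psi> \<preceq> \<theta>\<close> with \<open>\<theta>\<close> in \<^const>\<open>W\<close> and inside the join \<open>wJoin\<close>; by \<open>wJoin_lub\<close>,
  these do not change when the product is replaced by its reflection \<open>wJoin {\<phi> \<star> \<psi>}\<close> into \<^const>\<open>W\<close>.
\<close>

definition wstar :: "(real \<Rightarrow> real \<Rightarrow> real) \<Rightarrow> (real \<Rightarrow> real) \<Rightarrow> (real \<Rightarrow> real) \<Rightarrow> (real \<Rightarrow> real)" where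
  "wstar S \<phi> \<psi> = (\<lambda>u\<in>{0<..}. Inf {S (\<phi> t) (\<psi> s) | t s. 0 < t \<and> 0 < s \<and> u = t + s})"

text \<open>
  Meets for \<open>\<preceq>\<close> are pointwise suprema; \<^const>\<open>wunit\<close> is the top element, inserted to cover the empty
  meet. A join is the meet of all upper bounds in \<^const>\<open>W\<close>.
\<close>

definition wMeet :: "(real \<Rightarrow> real) set \<Rightarrow> (real \<Rightarrow> real)" where
  "wMeet F = (\<lambda>t\<in>{0<..}. SUP \<phi>\<in>insert wunit F. \<phi> t)"

definition wJoin :: "(real \<Rightarrow> real) set \<Rightarrow> (real \<Rightarrow> real)" where
  "wJoin F = wMeet {\<sigma> \<in> W. \<forall>\<phi>\<in>F. \<phi> \<preceq> \<sigma>}"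

text \<open>The residual: \<open>\<theta> \<star> \<phi> \<preceq> \<psi>\<close> iff \<open>\<theta> \<preceq> whom S \<phi> \<psi>\<close>.\<close>

definition whom :: "(real \<Rightarrow> real \<Rightarrow> real) \<Rightarrow> (real \<Rightarrow> real) \<Rightarrow> (real \<Rightarrow> real) \<Rightarrow> (real \<Rightarrow> real)" where
  "whom S \<phi> \<psi> = wJoin {\<theta> \<in> W. wstar S \<theta> \<phi> \<preceq> \<psi>}"

lemma wunit_in_W: "wunit \<in> W"
proof -
  have "continuous (at_right t) wunit" if "t > 0" for t :: real
  proof -
    have "((\<lambda>_. 0) \<longlongrightarrow> (0::real)) (at_right t)" by simp
    then have "(wunit \<longlongrightarrow> 0) (at_right t)"
      by (rule Lim_transform_eventually)
         (use that in \<open>auto simp: wunit_def eventually_at_right_field intro!: exI[of _ "t + 1"]\<close>)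
    then show ?thesis using that by (simp add: continuous_within wunit_def)
  qed
  then show ?thesis by (auto simp: W_def wunit_def monotone_on_def)
qed

lemma wMeet_glb:
  assumes "F \<subseteq> W"
  shows "wMeet F \<in> W"
    and "\<sigma> \<in> W \<Longrightarrow> \<sigma> \<preceq> wMeet F \<longleftrightarrow> (\<forall>\<phi>\<in>F. \<sigma> \<preceq> \<phi>)"
proof -
  let ?F = "insert wunit F"
  have FW: "?F \<subseteq> W" using assms wunit_in_W by auto
  have bounds: "0 \<le> \<phi> t" "\<phi> t \<le> 1" if "\<phi> \<in> ?F" "t > 0" for \<phi> t
    using FW that by (auto simp: W_def PiE_iff)
  have bdd: "bdd_above ((\<lambda>\<phi>. \<phi> t) ` ?F)" if "t > 0" for t
    using bounds(2) that by (intro bdd_aboveI2[where M = 1]) auto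
  have val: "wMeet F t = (SUP \<phi>\<in>?F. \<phi> t)" if "t > 0" for t
    using that by (simp add: wMeet_def)
  have up: "\<phi> t \<le> wMeet F t" if "\<phi> \<in> ?F" "t > 0" for \<phi> t
    unfolding val[OF that(2)] by (rule cSUP_upper[OF that(1) bdd[OF that(2)]])
  have least: "wMeet F t \<le> c" if "t > 0" "\<And>\<phi>. \<phi> \<in> ?F \<Longrightarrow> \<phi> t \<le> c" for t c
    unfolding val[OF that(1)] by (rule cSUP_least) (use that in auto)
  have ge0: "0 \<le> wMeet F t" if "t > 0" for t
    using up[of wunit t] that by (simp add: wunit_def)
  have anti: "wMeet F s \<ge> wMeet F t" if "0 < s" "s \<le> t" for s t
  proof (rule least)
    show "0 < t" using that by simp
    fix \<phi> assume "\<phi> \<in> ?F"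
    moreover from this have "\<phi> t \<le> \<phi> s"
      using FW that by (auto simp: W_def monotone_on_def)
    ultimately show "\<phi> t \<le> wMeet F s" using up[of \<phi> s] that by simp
  qed
  have cont: "continuous (at_right t) (wMeet F)" if t: "t > 0" for t
    unfolding continuous_within
  proof (rule order_tendstoI)
    fix a assume "a < wMeet F t"
    then obtain \<phi> where \<phi>: "\<phi> \<in> ?F" "a < \<phi> t"
      using least[OF t, of a] by (meson not_le)
    then have "(\<phi> \<longlongrightarrow> \<phi> t) (at_right t)"
      using FW t by (auto simp: W_def continuous_within)
    then have "eventually (\<lambda>s. a < \<phi> s) (at_right t)"
      using \<phi>(2) by (rule order_tendstoD)
    moreover have "eventually (\<lambda>s. t < s) (at_right t)" by (rule eventually_at_right_less)
    ultimately show "eventually (\<lambda>s. a < wMeet F s) (at_right t)"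
    proof eventually_elim
      case (elim s)
      then show ?case using up[OF \<phi>(1), of s] t by linarith
    qed
  next
    fix a assume a: "a > wMeet F t"
    have "eventually (\<lambda>s. t < s) (at_right t)" by (rule eventually_at_right_less)
    then show "eventually (\<lambda>s. wMeet F s < a) (at_right t)"
    proof eventually_elim
      case (elim s)
      then show ?case using anti[of t s] t a by linarith
    qed
  qed
  have "wMeet F t \<le> 1" if "t > 0" for t by (rule least) (use bounds that in auto)
  then show "wMeet F \<in> W"
    using ge0 anti cont by (auto simp: W_def monotone_on_def PiE_iff wMeet_def extensional_def)
  show "\<sigma> \<preceq> wMeet F \<longleftrightarrow> (\<forall>\<phi>\<in>F. \<sigma> \<preceq> \<phi>)" if "\<sigma> \<in> W"
  proof
    assume "\<sigma> \<preceq> wMeet F"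
    then show "\<forall>\<phi>\<in>F. \<sigma> \<preceq> \<phi>" using up unfolding wle_def by (meson insertCI order_trans)
  next
    assume *: "\<forall>\<phi>\<in>F. \<sigma> \<preceq> \<phi>"
    have "0 \<le> \<sigma> t" if "t > 0" for t using \<open>\<sigma> \<in> W\<close> that by (auto simp: W_def PiE_iff)
    with * show "\<sigma> \<preceq> wMeet F" unfolding wle_def
      by (auto intro!: least simp: wunit_def)
  qed
qed

lemma wJoin_lub:
  assumes "\<And>\<phi> t. \<phi> \<in> F \<Longrightarrow> t > 0 \<Longrightarrow> 0 \<le> \<phi> t"
  shows "wJoin F \<in> W"
    and "\<sigma> \<in> W \<Longrightarrow> wJoin F \<preceq> \<sigma> \<longleftrightarrow> (\<forall>\<phi>\<in>F. \<phi> \<preceq> \<sigma>)"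
proof -
  let ?U = "{\<sigma> \<in> W. \<forall>\<phi>\<in>F. \<phi> \<preceq> \<sigma>}"
  have U: "?U \<subseteq> W" by auto
  show W: "wJoin F \<in> W" unfolding wJoin_def by (rule wMeet_glb(1)[OF U])
  have lower: "wJoin F \<preceq> \<tau>" if "\<tau> \<in> ?U" for \<tau>
    using wMeet_glb(2)[OF U W] that by (auto simp: wJoin_def wle_def)
  have upper: "\<phi> \<preceq> wJoin F" if "\<phi> \<in> F" for \<phi>
    unfolding wle_def
  proof (intro allI impI)
    fix t :: real assume t: "t > 0"
    have "(SUP \<sigma>\<in>insert wunit ?U. \<sigma> t) \<le> \<phi> t"
      by (rule cSUP_least) (use assms[OF that t] that t in \<open>auto simp: wunit_def wle_def\<close>)
    then show "wJoin F t \<le> \<phi> t" using t by (simp add: wJoin_def wMeet_def)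
  qed
  show "wJoin F \<preceq> \<sigma> \<longleftrightarrow> (\<forall>\<phi>\<in>F. \<phi> \<preceq> \<sigma>)" if "\<sigma> \<in> W"
    using lower[of \<sigma>] upper that unfolding wle_def by (auto intro: order_trans)
qed

section \<open>Enriched categories and modules\<close>

record 'a wcat =
  Ob :: "'a set"
  Hom :: "'a \<Rightarrow> 'a \<Rightarrow> real \<Rightarrow> real"

definition wcategory :: "(real \<Rightarrow> real \<Rightarrow> real) \<Rightarrow> 'a wcat \<Rightarrow> bool" where
  "wcategory S C \<longleftrightarrow>
     (\<forall>a\<in>Ob C. \<forall>b\<in>Ob C. Hom C a b \<in> W) \<and>
     (\<forall>a\<in>Ob C. \<forall>b\<in>Ob C. \<forall>c\<in>Ob C. wstar S (Hom C a b) (Hom C b c) \<preceq> Hom C a c) \<and>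
     (\<forall>a\<in>Ob C. wunit \<preceq> Hom C a a)"

definition symmetric_wcat :: "'a wcat \<Rightarrow> bool" where
  "symmetric_wcat C \<longleftrightarrow> (\<forall>a\<in>Ob C. \<forall>b\<in>Ob C. Hom C a b = Hom C b a)"

definition wcat_uniformity :: "'a wcat \<Rightarrow> ('a \<times> 'a) filter" where
  "wcat_uniformity C =
     (INF r\<in>{0<..<1}. INF t\<in>{0<..}.
        principal {(a, b). a \<in> Ob C \<and> b \<in> Ob C \<and> Hom C a b t < r \<and> Hom C b a t < r})"

definition unit_wcat :: "unit wcat" where
  "unit_wcat = \<lparr>Ob = UNIV, Hom = (\<lambda>_ _. wunit)\<rparr>"

text \<open>
  A module from \<open>C\<close> to \<open>D\<close> is a functor from \<open>D\<^sup>o\<^sup>p \<otimes> C\<close> to the base: the first argument of \<open>M\<close>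
  ranges over the objects of \<open>D\<close>, the second over those of \<open>C\<close>.
\<close>

definition wmodule ::
    "(real \<Rightarrow> real \<Rightarrow> real) \<Rightarrow> 'c wcat \<Rightarrow> 'd wcat \<Rightarrow> ('d \<Rightarrow> 'c \<Rightarrow> real \<Rightarrow> real) \<Rightarrow> bool" where
  "wmodule S C D M \<longleftrightarrow>
     wcategory S C \<and> wcategory S D \<and>
     (\<forall>d\<in>Ob D. \<forall>c\<in>Ob C. M d c \<in> W) \<and>
     (\<forall>d'\<in>Ob D. \<forall>d\<in>Ob D. \<forall>c\<in>Ob C. wstar S (Hom D d' d) (M d c) \<preceq> M d' c) \<and>
     (\<forall>d\<in>Ob D. \<forall>c\<in>Ob C. \<forall>c'\<in>Ob C. wstar S (M d c) (Hom C c c') \<preceq> M d c')"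

text \<open>The composite of \<open>M\<close> from \<open>C\<close> to \<open>D\<close> with \<open>N\<close> from \<open>D\<close> to \<open>E\<close>.\<close>

definition wmodule_comp ::
    "(real \<Rightarrow> real \<Rightarrow> real) \<Rightarrow> 'd wcat \<Rightarrow> ('e \<Rightarrow> 'd \<Rightarrow> real \<Rightarrow> real) \<Rightarrow> ('d \<Rightarrow> 'c \<Rightarrow> real \<Rightarrow> real)
      \<Rightarrow> 'e \<Rightarrow> 'c \<Rightarrow> real \<Rightarrow> real" where
  "wmodule_comp S D N M e c = wJoin ((\<lambda>d. wstar S (N e d) (M d c)) ` Ob D)"

text \<open>
  \<open>M\<close> (from \<open>C\<close> to \<open>D\<close>) is left adjoint to \<open>N\<close> (from \<open>D\<close> to \<open>C\<close>): unit \<open>1\<^sub>C \<le> N \<circ> M\<close> and counit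
  \<open>M \<circ> N \<le> 1\<^sub>D\<close>. The bicategory is locally ordered, so the triangle identities are automatic.
\<close>

definition wmodule_adjoint ::
    "(real \<Rightarrow> real \<Rightarrow> real) \<Rightarrow> 'c wcat \<Rightarrow> 'd wcat \<Rightarrow> ('d \<Rightarrow> 'c \<Rightarrow> real \<Rightarrow> real)
      \<Rightarrow> ('c \<Rightarrow> 'd \<Rightarrow> real \<Rightarrow> real) \<Rightarrow> bool" where
  "wmodule_adjoint S C D M N \<longleftrightarrow>
     wmodule S C D M \<and> wmodule S D C N \<and>
     (\<forall>c\<in>Ob C. \<forall>c'\<in>Ob C. Hom C c c' \<preceq> wmodule_comp S D N M c c') \<and>
     (\<forall>d\<in>Ob D. \<forall>d'\<in>Ob D. wmodule_comp S C M N d d' \<preceq> Hom D d d')"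

section \<open>Presheaves and the Cauchy completion\<close>

text \<open>
  A presheaf on \<open>C\<close> is a module from \<^const>\<open>unit_wcat\<close> to \<open>C\<close>, recorded as a function on \<open>Ob C\<close>;
  it is \<open>undefined\<close> off \<open>Ob C\<close>, so that equal presheaves are equal as HOL functions.
\<close>

definition presheaf_cat :: "(real \<Rightarrow> real \<Rightarrow> real) \<Rightarrow> 'a wcat \<Rightarrow> ('a \<Rightarrow> real \<Rightarrow> real) wcat" where
  "presheaf_cat S C =
     \<lparr>Ob = {\<Phi> \<in> Ob C \<rightarrow>\<^sub>E W. wmodule S unit_wcat C (\<lambda>a _. \<Phi> a)},
      Hom = (\<lambda>\<Phi> \<Psi>. wMeet ((\<lambda>a. whom S (\<Phi> a) (\<Psi> a)) ` Ob C))\<rparr>"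

definition cauchy_completion :: "(real \<Rightarrow> real \<Rightarrow> real) \<Rightarrow> 'a wcat \<Rightarrow> ('a \<Rightarrow> real \<Rightarrow> real) wcat" where
  "cauchy_completion S C =
     \<lparr>Ob = {\<Phi> \<in> Ob (presheaf_cat S C). \<exists>N. wmodule_adjoint S unit_wcat C (\<lambda>a _. \<Phi> a) N},
      Hom = Hom (presheaf_cat S C)\<rparr>"

definition yoneda :: "'a wcat \<Rightarrow> 'a \<Rightarrow> 'a \<Rightarrow> real \<Rightarrow> real" where
  "yoneda C a = (\<lambda>b\<in>Ob C. Hom C b a)"

section \<open>The enriched category of a gauge\<close>

definition wsym ::
    "(real \<Rightarrow> real \<Rightarrow> real) \<Rightarrow> ('a \<Rightarrow> 'a \<Rightarrow> real \<Rightarrow> real) \<Rightarrow> 'a \<Rightarrow> 'a \<Rightarrow> real \<Rightarrow> real" where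
  "wsym S w x y t = S (w x y t) (w y x t)"

definition gauge_wcat ::
    "(real \<Rightarrow> real \<Rightarrow> real) \<Rightarrow> 'a set \<Rightarrow> ('a \<Rightarrow> 'a \<Rightarrow> real \<Rightarrow> real) \<Rightarrow> 'a wcat" where
  "gauge_wcat S X w = \<lparr>Ob = X, Hom = (\<lambda>x y. \<lambda>t\<in>{0<..}. wsym S w x y t)\<rparr>"

lemma gauge_wcat_symmetric:
  assumes S: "continuous_tconorm S" and w: "quasi_modular_gauge S X w"
  shows "wcategory S (gauge_wcat S X w)" and "symmetric_wcat (gauge_wcat S X w)"
proof -
  have range: "S a b \<in> {0..1}" if "a \<in> {0..1}" "b \<in> {0..1}" for a b
    using S that unfolding continuous_tconorm_def tconorm_def by blast
  have comm: "S a b = S b a" if "a \<in> {0..1}" "b \<in> {0..1}" for a b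
    using S that unfolding continuous_tconorm_def tconorm_def by blast
  have assoc: "S (S a b) c = S a (S b c)" if "a \<in> {0..1}" "b \<in> {0..1}" "c \<in> {0..1}" for a b c
    using S that unfolding continuous_tconorm_def tconorm_def by blast
  have mono: "S a b \<le> S a' b'" if "a \<in> {0..1}" "b \<in> {0..1}" "a' \<in> {0..1}" "b' \<in> {0..1}"
    "a \<le> a'" "b \<le> b'" for a b a' b'
    using S that unfolding continuous_tconorm_def tconorm_def by blast
  have w_range: "\<forall>x\<in>X. \<forall>y\<in>X. \<forall>t>0. w x y t \<in> {0..<1}"
    and w_zero: "\<forall>x\<in>X. \<forall>y\<in>X. \<forall>t>0. w x y t = 0 \<longleftrightarrow> x = y"
    and w_tri: "\<forall>x\<in>X. \<forall>y\<in>X. \<forall>z\<in>X. \<forall>s>0. \<forall>t>0. w x z (t + s) \<le> S (w x y t) (w y z s)"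
    and w_cont: "\<forall>x\<in>X. \<forall>y\<in>X. continuous_on {0<..} (w x y) \<and> antimono_on {0<..} (w x y)"
    using w unfolding quasi_modular_gauge_def by - (elim conjE, assumption)+
  have w01: "w x y t \<in> {0..1}" if "x \<in> X" "y \<in> X" "t > 0" for x y t
  proof -
    have "w x y t \<in> {0..<1}" using w_range that by blast
    then show ?thesis by simp
  qed
  have w0: "w x x t = 0" if "x \<in> X" "t > 0" for x t
    using w_zero that by blast
  have tri: "w x z (t + s) \<le> S (w x y t) (w y z s)"
    if "x \<in> X" "y \<in> X" "z \<in> X" "t > 0" "s > 0" for x y z t s
    using w_tri that by blast
  have wcont: "continuous_on {0<..} (w x y)" if "x \<in> X" "y \<in> X" for x y
    using w_cont that by blast
  have anti: "w x y t \<le> w x y s" if "x \<in> X" "y \<in> X" "0 < s" "s \<le> t" for x y s t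
  proof -
    have "antimono_on {0<..} (w x y)" using w_cont that by blast
    then show ?thesis by (rule monotone_onD) (use that in simp_all)
  qed
  let ?h = "\<lambda>x y. \<lambda>t\<in>{0<..}. wsym S w x y t"
  have hom_W: "?h x y \<in> W" if xy: "x \<in> X" "y \<in> X" for x y
  proof -
    have "continuous_on {0<..} (\<lambda>t. (\<lambda>(a, b). S a b) (w x y t, w y x t))"
    proof (rule continuous_on_compose2[where t = "{0..1} \<times> {0..1}"])
      show "continuous_on ({0..1} \<times> {0..1}) (\<lambda>(a, b). S a b)"
        using S by (simp add: continuous_tconorm_def)
      show "continuous_on {0<..} (\<lambda>t. (w x y t, w y x t))"
        by (intro continuous_on_Pair wcont xy)
    qed (use w01 xy in auto)
    then have "continuous_on {0<..} (?h x y)"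
      by (rule continuous_on_eq) (simp add: wsym_def)
    then have isc: "\<forall>t\<in>{0<..}. isCont (?h x y) t"
      unfolding continuous_on_eq_continuous_at[OF open_greaterThan] .
    have right: "continuous (at_right t) (?h x y)" if "t > 0" for t
    proof (rule continuous_at_imp_continuous_at_within)
      show "isCont (?h x y) t" by (rule bspec[OF isc]) (use that in simp)
    qed
    have dec: "?h x y t \<le> ?h x y s" if "0 < s" "s \<le> t" for s t
      using that xy by (auto simp: wsym_def intro!: mono w01 anti)
    have "wsym S w x y t \<in> {0..1}" if "t > 0" for t
      unfolding wsym_def by (intro range w01 xy that)
    then have "?h x y \<in> {0<..} \<rightarrow>\<^sub>E {0..1}" by auto
    moreover have "antimono_on {0<..} (?h x y)"
      by (rule monotone_onI) (use dec in simp)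
    ultimately show ?thesis using right unfolding W_def by simp
  qed
  have comp: "wstar S (?h x y) (?h y z) \<preceq> ?h x z" if xyz: "x \<in> X" "y \<in> X" "z \<in> X" for x y z
  proof -
    have "wsym S w x z (t + s) \<le> S (wsym S w x y t) (wsym S w y z s)" if ts: "t > 0" "s > 0" for t s
    proof -
      let ?a = "w x y t" and ?b = "w y x t" and ?c = "w y z s" and ?d = "w z y s"
      have in01: "?a \<in> {0..1}" "?b \<in> {0..1}" "?c \<in> {0..1}" "?d \<in> {0..1}"
        using w01 xyz ts by blast+
      have "w z x (t + s) \<le> S ?d ?b"
        using tri[of z y x s t] xyz ts by (simp add: add.commute)
      then have "w z x (t + s) \<le> S ?b ?d" using comm[OF in01(2,4)] by simp
      moreover have "w x z (t + s) \<in> {0..1}" "w z x (t + s) \<in> {0..1}"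
        by (rule w01; use xyz ts in simp)+
      ultimately have "wsym S w x z (t + s) \<le> S (S ?a ?c) (S ?b ?d)"
        unfolding wsym_def using tri[of x y z t s] xyz ts
        by (intro mono range[OF in01(1,3)] range[OF in01(2,4)])
      also have "\<dots> = S ?a (S ?c (S ?b ?d))"
        by (rule assoc[OF in01(1,3) range[OF in01(2,4)]])
      also have "S ?c (S ?b ?d) = S (S ?c ?b) ?d" by (rule assoc[OF in01(3,2,4), symmetric])
      also have "S ?c ?b = S ?b ?c" by (rule comm[OF in01(3,2)])
      also have "S (S ?b ?c) ?d = S ?b (S ?c ?d)" by (rule assoc[OF in01(2,3,4)])
      also have "S ?a (S ?b (S ?c ?d)) = S (S ?a ?b) (S ?c ?d)"
        by (rule assoc[OF in01(1,2) range[OF in01(3,4)], symmetric])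
      finally show ?thesis by (simp add: wsym_def)
    qed
    note sub = this
    show ?thesis unfolding wle_def
    proof (intro allI impI)
      fix u :: real assume u: "u > 0"
      let ?V = "{S (?h x y t) (?h y z s) | t s. 0 < t \<and> 0 < s \<and> u = t + s}"
      have "S (?h x y (u / 2)) (?h y z (u / 2)) \<in> ?V"
        using u by (intro CollectI exI[of _ "u / 2"]) simp
      then have "?V \<noteq> {}" by blast
      then have "?h x z u \<le> Inf ?V"
        by (rule cInf_greatest) (use sub u in auto)
      then show "?h x z u \<le> wstar S (?h x y) (?h y z) u"
        using u by (simp add: wstar_def)
    qed
  qed
  have "wunit \<preceq> ?h x x" if "x \<in> X" for x
  proof -
    have "S 0 0 = 0" using S unfolding continuous_tconorm_def tconorm_def by simp
    then show ?thesis using w0 that by (simp add: wle_def wunit_def wsym_def)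
  qed
  then show "wcategory S (gauge_wcat S X w)"
    using hom_W comp by (simp add: wcategory_def gauge_wcat_def)
  have "?h x y = ?h y x" if "x \<in> X" "y \<in> X" for x y
    unfolding wsym_def by (intro restrict_ext comm w01 that) auto
  then show "symmetric_wcat (gauge_wcat S X w)"
    by (simp add: symmetric_wcat_def gauge_wcat_def)
qed

end

theory Submission imports Defs begin

text \<open>
  Over a symmetric \<^const>\<open>W\<close>-category \<open>C\<close> a presheaf with a right adjoint is adjoint to its own transpose.
  Cauchy modules are therefore the functions \<open>\<Phi>\<close> with \<open>\<Phi> x (t + s) \<le> C(x, y)(t) \<oplus> \<Phi> y s\<close> and
  \<open>C(x, y)(t + s) \<le> \<Phi> x t \<oplus> \<Phi> y s\<close> that take arbitrarily small values at every time; they play the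
  role of the distance functions to the points of a metric completion. Testing the residual against
  step functions shows that \<open>Hom(\<Phi>, \<Psi>)(t) \<le> c\<close> iff \<open>\<Psi> a (t + s) \<le> c \<oplus> \<Phi> a s\<close> for all \<open>a\<close> and \<open>s\<close>. Hence
  \<open>Hom(yoneda a, \<Phi>) = \<Phi> a\<close> and \<open>Hom(\<Phi>, yoneda a) \<le> \<Phi> a\<close>, which makes the Yoneda map a uniform embedding
  with dense image, and a Cauchy filter of modules converges to the right-continuous regularization
  of its pointwise upper limit. Continuity of \<open>\<oplus>\<close> at \<open>(0, 0)\<close> identifies the two symmetric
  uniformities on \<open>X\<close>, and two completions of a uniform space are uniquely isomorphic.
\<close>

section \<open>Uniform completions are unique\<close>

text \<open>Applying the composition axiom twice and intersecting with the converse gives an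
  entourage whose threefold composite lies in \<open>E\<close>. Three links are what comparing
  points through nearby images of \<open>X\<close> takes: to an approximant, across, and
  back.\<close>

lemma uniformity_symmetric_root:
  assumes Y: "uniformity_carrier Y \<V>" and E: "eventually E \<V>"
  obtains D where "eventually D \<V>" "\<And>x y. D (x, y) \<Longrightarrow> D (y, x)"
    "\<And>x y z u. \<lbrakk>x \<in> Y; y \<in> Y; z \<in> Y; u \<in> Y; D (x, y); D (y, z); D (z, u)\<rbrakk> \<Longrightarrow> E (x, u)"
proof -
  have split: "\<exists>D. eventually D \<V> \<and> (\<forall>x\<in>Y. \<forall>y\<in>Y. \<forall>z\<in>Y. D (x, y) \<longrightarrow> D (y, z) \<longrightarrow> E (x, z))"
    if "eventually E \<V>" for E
    using Y that unfolding uniformity_carrier_def by blast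
  obtain D1 where D1: "eventually D1 \<V>"
    "\<And>x y z. \<lbrakk>x \<in> Y; y \<in> Y; z \<in> Y; D1 (x, y); D1 (y, z)\<rbrakk> \<Longrightarrow> E (x, z)"
    using split[OF E] by blast
  obtain D2 where D2: "eventually D2 \<V>"
    "\<And>x y z. \<lbrakk>x \<in> Y; y \<in> Y; z \<in> Y; D2 (x, y); D2 (y, z)\<rbrakk> \<Longrightarrow> D1 (x, z)"
    using split[OF D1(1)] by blast
  have D12: "eventually (\<lambda>p. D1 p \<and> D2 p) \<V>"
    using D1(1) D2(1) by (rule eventually_conj)
  then have "eventually (\<lambda>(x, y). D1 (y, x) \<and> D2 (y, x)) \<V>"
    using Y unfolding uniformity_carrier_def by blast
  with D12 have "eventually (\<lambda>(x, y). (D1 (x, y) \<and> D2 (x, y)) \<and> D1 (y, x) \<and> D2 (y, x)) \<V>"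
    by eventually_elim auto
  then show thesis
  proof (rule that)
    fix x y z u
    let ?D = "\<lambda>(x, y). (D1 (x, y) \<and> D2 (x, y)) \<and> D1 (y, x) \<and> D2 (y, x)"
    assume in_Y: "x \<in> Y" "y \<in> Y" "z \<in> Y" "u \<in> Y" and D: "?D (x, y)" "?D (y, z)" "?D (z, u)"
    have "D1 (x, z)" using D2(2)[OF in_Y(1-3)] D by auto
    then show "E (x, u)" using D1(2)[OF in_Y(1,3,4)] D by auto
  qed auto
qed

text \<open>Uniform continuity of the inverse concerns the trace filter on the image, so
  \<open>D\<close> has to be tested only on pairs of image points.\<close>

lemma uniform_embeddingI:
  assumes U: "\<U> \<le> principal (X \<times> X)" and j: "j \<in> X \<rightarrow> Y" "inj_on j X"
    and cont: "\<And>E. eventually E \<V> \<Longrightarrow> eventually (\<lambda>(x, y). E (j x, j y)) \<U>"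
    and refl: "\<And>E. eventually E \<U> \<Longrightarrow>
      \<exists>D. eventually D \<V> \<and> (\<forall>x\<in>X. \<forall>y\<in>X. D (j x, j y) \<longrightarrow> E (x, y))"
  shows "uniform_embedding X \<U> Y \<V> j"
proof -
  let ?V = "inf \<V> (principal (j ` X \<times> j ` X))"
  have in_X: "eventually (\<lambda>p. p \<in> X \<times> X) \<U>"
    using U by (simp add: le_principal)
  have "filterlim (map_prod j j) ?V \<U>"
    unfolding filterlim_iff
  proof (intro allI impI)
    fix E assume "eventually E ?V"
    then have "eventually (\<lambda>p. p \<in> j ` X \<times> j ` X \<longrightarrow> E p) \<V>"
      by (simp add: eventually_inf_principal)
    from cont[OF this] in_X show "eventually (\<lambda>p. E (map_prod j j p)) \<U>"
      by eventually_elim auto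
  qed
  moreover have "filterlim (map_prod (inv_into X j) (inv_into X j)) \<U> ?V"
    unfolding filterlim_iff
  proof (intro allI impI)
    fix E assume "eventually E \<U>"
    then obtain D where "eventually D \<V>" and D: "\<forall>x\<in>X. \<forall>y\<in>X. D (j x, j y) \<longrightarrow> E (x, y)"
      using refl by blast
    then have "eventually (\<lambda>p. p \<in> j ` X \<times> j ` X \<longrightarrow> E (map_prod (inv_into X j) (inv_into X j) p)) \<V>"
      by (rule_tac eventually_mono[where P = D]) (auto simp: j(2))
    then show "eventually (\<lambda>p. E (map_prod (inv_into X j) (inv_into X j) p)) ?V"
      by (simp add: eventually_inf_principal)
  qed
  ultimately show ?thesis
    using j unfolding uniform_embedding_def bi_uniform_iso_def uniformly_continuous_map_def
    by (auto intro: inv_into_into simp: bij_betw_def)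
qed

lemma uniform_embeddingD:
  assumes "uniform_embedding X \<U> Y \<V> j"
  shows "j \<in> X \<rightarrow> Y"
    and "eventually E \<V> \<Longrightarrow> eventually (\<lambda>(x, y). E (j x, j y)) \<U>"
    and "eventually E' \<U> \<Longrightarrow>
      \<exists>D. eventually D \<V> \<and> (\<forall>x\<in>X. \<forall>y\<in>X. D (j x, j y) \<longrightarrow> E' (x, y))"
proof -
  let ?V = "inf \<V> (principal (j ` X \<times> j ` X))"
  let ?i = "inv_into X j"
  from assms show "j \<in> X \<rightarrow> Y" by (simp add: uniform_embedding_def)
  from assms have j: "inj_on j X" "filterlim (map_prod j j) ?V \<U>" "filterlim (map_prod ?i ?i) \<U> ?V"
    by (simp_all add: uniform_embedding_def bi_uniform_iso_def uniformly_continuous_map_def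
        bij_betw_def)
  show "eventually (\<lambda>(x, y). E (j x, j y)) \<U>" if "eventually E \<V>"
  proof -
    from that have "eventually E ?V"
      by (rule eventually_inf_principal[THEN iffD2, OF eventually_mono]) simp
    with j(2) show ?thesis by (auto simp: filterlim_iff map_prod_def case_prod_unfold)
  qed
  show "\<exists>D. eventually D \<V> \<and> (\<forall>x\<in>X. \<forall>y\<in>X. D (j x, j y) \<longrightarrow> E' (x, y))"
    if "eventually E' \<U>"
  proof -
    from that j(3) have "eventually (\<lambda>p. E' (map_prod ?i ?i p)) ?V"
      by (simp add: filterlim_iff)
    then have "eventually (\<lambda>p. p \<in> j ` X \<times> j ` X \<longrightarrow> E' (map_prod ?i ?i p)) \<V>"
      by (simp add: eventually_inf_principal)
    then show ?thesis using j(1) by (intro exI conjI) auto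
  qed
qed

text \<open>
  The graph of the comparison map between two completions. Its definition is symmetric in the two
  completions, so that every property of the map also holds for its inverse.
\<close>

definition completion_graph ::
    "'a set \<Rightarrow> ('b \<times> 'b) filter \<Rightarrow> ('a \<Rightarrow> 'b) \<Rightarrow> ('c \<times> 'c) filter \<Rightarrow> ('a \<Rightarrow> 'c) \<Rightarrow> 'b \<Rightarrow> 'c \<Rightarrow> bool" where
  "completion_graph X \<V> j \<W> k y z \<longleftrightarrow>
     (\<forall>E D. eventually E \<V> \<longrightarrow> eventually D \<W> \<longrightarrow> (\<exists>x\<in>X. E (y, j x) \<and> D (z, k x)))"

lemma completion_graph_sym: "completion_graph X \<V> j \<W> k y z \<longleftrightarrow> completion_graph X \<W> k \<V> j z y"
  by (auto simp: completion_graph_def)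

lemma completion_graph_embedding:
  assumes "uniform_completion X \<U> Y \<V> j" and "uniform_completion X \<U> Z \<W> k" and "x \<in> X"
  shows "completion_graph X \<V> j \<W> k (j x) (k x)"
proof -
  have "E (j x, j x) \<and> D (k x, k x)" if "eventually E \<V>" "eventually D \<W>" for E D
    using assms that uniform_embeddingD(1)[of X \<U> Y \<V> j] uniform_embeddingD(1)[of X \<U> Z \<W> k]
    unfolding uniform_completion_def uniformity_carrier_def by blast
  with \<open>x \<in> X\<close> show ?thesis unfolding completion_graph_def by blast
qed

text \<open>Both chains have three links: \<open>j x\<close>, \<open>y\<close>, \<open>y'\<close>,
  \<open>j x'\<close> in \<open>Y\<close>, then \<open>z\<close>, \<open>k x\<close>,
  \<open>k x'\<close>, \<open>z'\<close> in \<open>Z\<close>. The first conclusion yields continuity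
  and uniqueness of the comparison map; the second makes the filter of approximants of
  \<open>y\<close> Cauchy after transport by \<open>k\<close>.\<close>

lemma completion_graph_uniformly_continuous:
  assumes Y: "uniform_completion X \<U> Y \<V> j" and Z: "uniform_completion X \<U> Z \<W> k"
    and D: "eventually D \<W>"
  obtains E where "eventually E \<V>"
    "\<And>y y' z z'. \<lbrakk>y \<in> Y; y' \<in> Y; z \<in> Z; z' \<in> Z; completion_graph X \<V> j \<W> k y z;
       completion_graph X \<V> j \<W> k y' z'; E (y, y')\<rbrakk> \<Longrightarrow> D (z, z')"
    "\<And>y x x'. \<lbrakk>y \<in> Y; x \<in> X; x' \<in> X; E (y, j x); E (y, j x')\<rbrakk> \<Longrightarrow> D (k x, k x')"
proof -
  have Yu: "uniformity_carrier Y \<V>" and Zu: "uniformity_carrier Z \<W>"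
    and je: "uniform_embedding X \<U> Y \<V> j" and ke: "uniform_embedding X \<U> Z \<W> k"
    using Y Z by (simp_all add: uniform_completion_def)
  have jY: "j x \<in> Y" and kZ: "k x \<in> Z" if "x \<in> X" for x
    using uniform_embeddingD(1)[OF je] uniform_embeddingD(1)[OF ke] that by auto
  obtain D' where D': "eventually D' \<W>" "\<And>x y. D' (x, y) \<Longrightarrow> D' (y, x)"
    "\<And>x y z u. \<lbrakk>x \<in> Z; y \<in> Z; z \<in> Z; u \<in> Z; D' (x, y); D' (y, z); D' (z, u)\<rbrakk> \<Longrightarrow> D (x, u)"
    using uniformity_symmetric_root[OF Zu D] by blast
  have D'_refl: "D' (z, z)" if "z \<in> Z" for z
    using Zu D'(1) that unfolding uniformity_carrier_def by blast
  \<comment> \<open>Pulling \<open>D'\<close> back along \<open>k\<close> gives an entourage of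
    \<open>X\<close>; since \<open>j\<close> is an embedding, some entourage of \<open>Y\<close>
    refines it on images of \<open>j\<close>.\<close>
  obtain E0 where E0: "eventually E0 \<V>"
    "\<And>x x'. \<lbrakk>x \<in> X; x' \<in> X; E0 (j x, j x')\<rbrakk> \<Longrightarrow> D' (k x, k x')"
    using uniform_embeddingD(3)[OF je uniform_embeddingD(2)[OF ke D'(1)]] by auto
  obtain E where E: "eventually E \<V>" "\<And>x y. E (x, y) \<Longrightarrow> E (y, x)"
    "\<And>x y z u. \<lbrakk>x \<in> Y; y \<in> Y; z \<in> Y; u \<in> Y; E (x, y); E (y, z); E (z, u)\<rbrakk> \<Longrightarrow> E0 (x, u)"
    using uniformity_symmetric_root[OF Yu E0(1)] by blast
  have E_refl: "E (y, y)" if "y \<in> Y" for y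
    using Yu E(1) that unfolding uniformity_carrier_def by blast
  show thesis
  proof (rule that[OF E(1)])
    fix y y' z z'
    assume pts: "y \<in> Y" "y' \<in> Y" "z \<in> Z" "z' \<in> Z" and yy': "E (y, y')"
      and G: "completion_graph X \<V> j \<W> k y z" "completion_graph X \<V> j \<W> k y' z'"
    obtain x where x: "x \<in> X" "E (y, j x)" "D' (z, k x)"
      using G(1) E(1) D'(1) unfolding completion_graph_def by blast
    obtain x' where x': "x' \<in> X" "E (y', j x')" "D' (z', k x')"
      using G(2) E(1) D'(1) unfolding completion_graph_def by blast
    have "E0 (j x, j x')"
      using E(3)[of "j x" y y' "j x'"] E(2) pts yy' x x' jY by blast
    then have "D' (k x, k x')" using E0(2) x x' by blast
    then show "D (z, z')"
      using D'(3)[of z "k x" "k x'" z'] D'(2) pts x x' kZ by blast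
  next
    fix y x x' assume pts: "y \<in> Y" "x \<in> X" "x' \<in> X" and "E (y, j x)" "E (y, j x')"
    \<comment> \<open>The path through \<open>y\<close> has only two links, so a reflexive link pads
      it to three.\<close>
    then have "E0 (j x, j x')"
      using E(3)[of "j x" y "j x'" "j x'"] E(2) E_refl jY by blast
    then have "D' (k x, k x')" using E0(2) pts by blast
    then show "D (k x, k x')"
      using D'(3)[of "k x" "k x'" "k x'" "k x'"] D'_refl pts kZ by blast
  qed
qed

text \<open>The traces on \<open>X\<close> of the neighbourhoods of \<open>y\<close> generate the
  filter \<open>G\<close>. Density makes it proper, its image under \<open>k\<close> is Cauchy, and
  a limit of that image in \<open>Z\<close> is related to \<open>y\<close>.\<close>

lemma completion_graph_exists:
  assumes Y: "uniform_completion X \<U> Y \<V> j" and Z: "uniform_completion X \<U> Z \<W> k"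
    and y: "y \<in> Y"
  shows "\<exists>z\<in>Z. completion_graph X \<V> j \<W> k y z"
proof -
  define G where "G = inf (filtercomap (\<lambda>x. (y, j x)) \<V>) (principal X)"
  let ?F = "filtermap k G"
  have ke: "uniform_embedding X \<U> Z \<W> k" using Z by (simp add: uniform_completion_def)
  have ev_G: "eventually P G \<longleftrightarrow> (\<exists>E. eventually E \<V> \<and> (\<forall>x\<in>X. E (y, j x) \<longrightarrow> P x))" for P
    unfolding G_def eventually_inf_principal eventually_filtercomap by blast
  have dense: "\<exists>x\<in>X. E (y, j x)" if "eventually E \<V>" for E
    using Y y that by (simp add: uniform_completion_def dense_image_def)
  have "?F \<noteq> bot"
    using dense unfolding trivial_limit_def eventually_filtermap ev_G by blast
  moreover have "?F \<le> principal Z"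
  proof -
    have "eventually (\<lambda>_. True) \<V>" by simp
    then have "\<exists>E. eventually E \<V> \<and> (\<forall>x\<in>X. E (y, j x) \<longrightarrow> k x \<in> Z)"
      using uniform_embeddingD(1)[OF ke] by blast
    then show ?thesis by (simp add: le_principal eventually_filtermap ev_G)
  qed
  moreover have "?F \<times>\<^sub>F ?F \<le> \<W>"
  proof (rule filter_leI)
    fix D assume "eventually D \<W>"
    then obtain E where E: "eventually E \<V>"
      "\<And>y x x'. \<lbrakk>y \<in> Y; x \<in> X; x' \<in> X; E (y, j x); E (y, j x')\<rbrakk> \<Longrightarrow> D (k x, k x')"
      using completion_graph_uniformly_continuous[OF Y Z] by metis
    let ?P = "\<lambda>z. \<exists>x\<in>X. E (y, j x) \<and> z = k x"
    have "eventually ?P ?F" unfolding eventually_filtermap ev_G using E(1) by blast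
    moreover have "D (z, z')" if "?P z" "?P z'" for z z' using that E(2) y by blast
    ultimately show "eventually D (?F \<times>\<^sub>F ?F)"
      unfolding eventually_prod_filter by blast
  qed
  ultimately obtain z where z: "z \<in> Z" "filterlim (Pair z) \<W> ?F"
    using Z unfolding uniform_completion_def complete_uniformity_def by blast
  have "completion_graph X \<V> j \<W> k y z"
    unfolding completion_graph_def
  proof (intro allI impI)
    fix E D assume E: "eventually E \<V>" and D: "eventually D \<W>"
    from z(2) D have "eventually (\<lambda>x. D (z, k x)) G"
      by (simp add: filterlim_iff eventually_filtermap)
    then obtain E' where E': "eventually E' \<V>" "\<forall>x\<in>X. E' (y, j x) \<longrightarrow> D (z, k x)"
      unfolding ev_G by blast
    \<comment> \<open>Density is applied to an intersection, so that a single \<open>x\<close>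
      serves both entourages.\<close>
    from dense[OF eventually_conj[OF E E'(1)]] E'(2)
    show "\<exists>x\<in>X. E (y, j x) \<and> D (z, k x)" by blast
  qed
  with z(1) show ?thesis by blast
qed

text \<open>Every entourage of \<open>Y\<close> contains \<open>(y, y)\<close>, so the continuity
  estimate puts \<open>(z, z')\<close> into every entourage of \<open>Z\<close>, and separatedness
  applies.\<close>

lemma completion_graph_unique:
  assumes Y: "uniform_completion X \<U> Y \<V> j" and Z: "uniform_completion X \<U> Z \<W> k"
    and "y \<in> Y" "z \<in> Z" "z' \<in> Z"
    and "completion_graph X \<V> j \<W> k y z" "completion_graph X \<V> j \<W> k y z'"
  shows "z = z'"
proof -
  have "D (z, z')" if D: "eventually D \<W>" for D
  proof -
    obtain E where E: "eventually E \<V>"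
      "\<And>y y' z z'. \<lbrakk>y \<in> Y; y' \<in> Y; z \<in> Z; z' \<in> Z; completion_graph X \<V> j \<W> k y z;
         completion_graph X \<V> j \<W> k y' z'; E (y, y')\<rbrakk> \<Longrightarrow> D (z, z')"
      using completion_graph_uniformly_continuous[OF Y Z D] by metis
    moreover have "E (y, y)"
      using Y E(1) assms(3) unfolding uniform_completion_def uniformity_carrier_def by blast
    ultimately show ?thesis using assms by blast
  qed
  then show ?thesis
    using Z assms(4,5) unfolding uniform_completion_def separated_uniformity_def by blast
qed

text \<open>This is the source of uniqueness: continuity of \<open>h\<close> carries approximants
  \<open>j x\<close> of \<open>y\<close> to approximants \<open>k x\<close> of \<open>h y\<close>,
  so the graph of any compatible isomorphism lies in the relation.\<close>

lemma completion_graph_iso: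
  assumes Y: "uniform_completion X \<U> Y \<V> j" and Z: "uniform_completion X \<U> Z \<W> k"
    and iso: "bi_uniform_iso Y \<V> Z \<W> h" and comp: "\<And>x. x \<in> X \<Longrightarrow> h (j x) = k x" and y: "y \<in> Y"
  shows "completion_graph X \<V> j \<W> k y (h y)"
  unfolding completion_graph_def
proof (intro allI impI)
  fix E D assume E: "eventually E \<V>" and D: "eventually D \<W>"
  from iso D have "eventually (\<lambda>p. D (map_prod h h p)) \<V>"
    by (simp add: bi_uniform_iso_def uniformly_continuous_map_def filterlim_iff)
  with E have "eventually (\<lambda>p. E p \<and> D (map_prod h h p)) \<V>" by (rule eventually_conj)
  with Y y have "\<exists>x\<in>X. E (y, j x) \<and> D (map_prod h h (y, j x))"
    unfolding uniform_completion_def dense_image_def by blast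
  then show "\<exists>x\<in>X. E (y, j x) \<and> D (h y, k x)" using comp by auto
qed

lemma completion_map_uniformly_continuous:
  assumes Y: "uniform_completion X \<U> Y \<V> j" and Z: "uniform_completion X \<U> Z \<W> k"
    and h: "\<And>y. y \<in> Y \<Longrightarrow> h y \<in> Z \<and> completion_graph X \<V> j \<W> k y (h y)"
  shows "uniformly_continuous_map Y \<V> Z \<W> h"
proof -
  have "eventually (\<lambda>p. D (map_prod h h p)) \<V>" if D: "eventually D \<W>" for D
  proof -
    obtain E where E: "eventually E \<V>"
      "\<And>y y' z z'. \<lbrakk>y \<in> Y; y' \<in> Y; z \<in> Z; z' \<in> Z; completion_graph X \<V> j \<W> k y z;
         completion_graph X \<V> j \<W> k y' z'; E (y, y')\<rbrakk> \<Longrightarrow> D (z, z')"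
      using completion_graph_uniformly_continuous[OF Y Z D] by metis
    have "eventually (\<lambda>p. p \<in> Y \<times> Y) \<V>"
      using Y by (simp add: uniform_completion_def uniformity_carrier_def le_principal)
    with E(1) show ?thesis
      by eventually_elim (use E(2) h in auto)
  qed
  then show ?thesis
    using h by (simp add: uniformly_continuous_map_def filterlim_iff)
qed

text \<open>The relation is total and single-valued in both directions, hence the graph of a
  bijection; one continuity lemma, read in either direction, serves the map and its inverse.
  Extensionality fixes the values off \<open>Y\<close>.\<close>

theorem uniform_completion_unique:
  assumes Y: "uniform_completion X \<U> Y \<V> j" and Z: "uniform_completion X \<U> Z \<W> k"
  shows "\<exists>!h. h \<in> extensional Y \<and> bi_uniform_iso Y \<V> Z \<W> h \<and> (\<forall>x\<in>X. h (j x) = k x)"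
proof (rule ex1I)
  let ?R = "completion_graph X \<V> j \<W> k"
  define h where "h = (\<lambda>y\<in>Y. THE z. z \<in> Z \<and> ?R y z)"
  have ex1: "\<exists>!z. z \<in> Z \<and> ?R y z" if "y \<in> Y" for y
    using completion_graph_exists[OF Y Z that] completion_graph_unique[OF Y Z that] by blast
  have h: "h y \<in> Z \<and> ?R y (h y)" if "y \<in> Y" for y
    using theI'[OF ex1[OF that]] that by (simp add: h_def)
  have h_eq: "h y = z" if "y \<in> Y" "z \<in> Z" "?R y z" for y z
    using completion_graph_unique[OF Y Z that(1)] h that by blast
  have inj: "inj_on h Y"
  proof (rule inj_onI)
    fix y y' assume "y \<in> Y" "y' \<in> Y" "h y = h y'"
    then show "y = y'"
      using completion_graph_unique[OF Z Y, of "h y" y y'] h[of y] h[of y']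
      by (simp add: completion_graph_sym[of X \<W>])
  qed
  have surj: "h ` Y = Z"
  proof
    show "h ` Y \<subseteq> Z" using h by blast
    show "Z \<subseteq> h ` Y"
    proof
      fix z assume z: "z \<in> Z"
      then obtain y where "y \<in> Y" "?R y z"
        using completion_graph_exists[OF Z Y z] completion_graph_sym[of X \<W>] by metis
      with z show "z \<in> h ` Y" using h_eq by blast
    qed
  qed
  have "uniformly_continuous_map Y \<V> Z \<W> h"
    by (rule completion_map_uniformly_continuous[OF Y Z h])
  moreover have "uniformly_continuous_map Z \<W> Y \<V> (inv_into Y h)"
  proof (rule completion_map_uniformly_continuous[OF Z Y])
    fix z assume "z \<in> Z"
    then have "inv_into Y h z \<in> Y" "h (inv_into Y h z) = z"
      using surj by (auto intro: inv_into_into f_inv_into_f)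
    then show "inv_into Y h z \<in> Y \<and> completion_graph X \<W> k \<V> j z (inv_into Y h z)"
      using h[of "inv_into Y h z"] by (simp add: completion_graph_sym[of X \<W>])
  qed
  ultimately have "bi_uniform_iso Y \<V> Z \<W> h"
    using inj surj by (simp add: bi_uniform_iso_def bij_betw_def)
  moreover have "h (j x) = k x" if "x \<in> X" for x
  proof (rule h_eq)
    show "j x \<in> Y" "k x \<in> Z"
      using Y Z that uniform_embeddingD(1) unfolding uniform_completion_def by blast+
    show "?R (j x) (k x)" by (rule completion_graph_embedding[OF Y Z that])
  qed
  ultimately show "h \<in> extensional Y \<and> bi_uniform_iso Y \<V> Z \<W> h \<and> (\<forall>x\<in>X. h (j x) = k x)"
    by (simp add: h_def)
  fix g assume g: "g \<in> extensional Y \<and> bi_uniform_iso Y \<V> Z \<W> g \<and> (\<forall>x\<in>X. g (j x) = k x)"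
  show "g = h"
  proof (rule extensionalityI[of _ Y])
    show "g \<in> extensional Y" "h \<in> extensional Y" using g by (simp_all add: h_def)
    fix y assume y: "y \<in> Y"
    have "g y \<in> Z" using g y by (auto simp: bi_uniform_iso_def bij_betw_def)
    then show "g y = h y"
      using h_eq[OF y] completion_graph_iso[OF Y Z _ _ y, of g] g by simp
  qed
qed

section \<open>Continuous t-conorms and the base of enrichment\<close>

lemma W_in: "\<lbrakk>f \<in> W; t > 0\<rbrakk> \<Longrightarrow> f t \<in> {0..1}"
  unfolding W_def PiE_iff by auto

lemma W_antimono: "\<lbrakk>f \<in> W; 0 < s; s \<le> t\<rbrakk> \<Longrightarrow> f t \<le> f s"
  unfolding W_def monotone_on_def by auto

lemma W_eqI:
  assumes "f \<in> W" "g \<in> W" "\<And>t. t > 0 \<Longrightarrow> f t = g t"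
  shows "f = g"
  using assms by (intro extensionalityI[of f "{0<..}" g]) (auto simp: W_def PiE_iff)

text \<open>Right continuity lets the delay \<open>u\<close> tend to 0. The losses of time in later
  estimates are removed in this way.\<close>

lemma W_right_limit_le:
  assumes f: "f \<in> W" "t > 0" and le: "\<And>u. u > 0 \<Longrightarrow> f (t + u) \<le> c"
  shows "f t \<le> c"
proof -
  have "(f \<longlongrightarrow> f t) (at_right t)"
    using f by (simp add: W_def continuous_within)
  moreover have "eventually (\<lambda>s. f s \<le> c) (at_right t)"
    using eventually_at_right_less[of t]
  proof eventually_elim
    case (elim s)
    then show ?case using le[of "s - t"] by simp
  qed
  ultimately show ?thesis by (rule tendsto_upperbound) simp
qed

text \<open>These are the test functions for joins and residuals. The strict comparison gives the
  lower value at \<tau> itself, which is what right continuity demands.\<close>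

lemma step_in_W:
  assumes "0 \<le> b" "b \<le> a" "a \<le> 1"
  shows "(\<lambda>t\<in>{0<..}. if t < \<tau> then a else b) \<in> W"
proof -
  let ?f = "\<lambda>t\<in>{0<..}. if t < \<tau> then a else b"
  have "(?f \<longlongrightarrow> ?f t) (at_right t)" if "t > 0" for t
  proof (rule tendsto_eventually)
    show "eventually (\<lambda>s. ?f s = ?f t) (at_right t)"
    proof (cases "t < \<tau>")
      case True
      then show ?thesis using that
        by (auto simp: eventually_at_right_field intro!: exI[of _ \<tau>])
    next
      case False
      then show ?thesis using that
        by (auto simp: eventually_at_right_field intro!: exI[of _ "t + 1"])
    qed
  qed
  then show ?thesis using assms by (auto simp: W_def continuous_within monotone_on_def)
qed

text \<open>The condition \<open>0 \<le> c\<close> accounts for \<open>wunit\<close>, which takes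
  part in every supremum defining a meet.\<close>

lemma wMeet_le_iff:
  assumes "F \<subseteq> W" "t > 0" "0 \<le> c"
  shows "wMeet F t \<le> c \<longleftrightarrow> (\<forall>f\<in>F. f t \<le> c)"
proof
  have "wMeet F \<preceq> f" if "f \<in> F" for f
    using wMeet_glb(2)[OF assms(1) wMeet_glb(1)[OF assms(1)]] that by (auto simp: wle_def)
  then show "wMeet F t \<le> c \<Longrightarrow> \<forall>f\<in>F. f t \<le> c"
    using assms(2) unfolding wle_def by (meson order_trans)
  show "wMeet F t \<le> c" if "\<forall>f\<in>F. f t \<le> c"
  proof -
    have "(SUP f\<in>insert wunit F. f t) \<le> c"
      by (rule cSUP_least) (use assms that in \<open>auto simp: wunit_def\<close>)
    then show ?thesis using assms(2) by (simp add: wMeet_def)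
  qed
qed

lemma wJoin_le:
  assumes "\<And>f t. f \<in> F \<Longrightarrow> t > 0 \<Longrightarrow> 0 \<le> f t" and "f \<in> F" "t > 0"
  shows "wJoin F t \<le> f t"
proof -
  have "wJoin F \<in> W" by (rule wJoin_lub(1)) (rule assms(1))
  with assms(1) have "wJoin F \<preceq> wJoin F \<longleftrightarrow> (\<forall>f\<in>F. f \<preceq> wJoin F)"
    by (rule wJoin_lub(2))
  then have "f \<preceq> wJoin F"
    using assms(2) by (simp add: wle_def)
  then show ?thesis using assms(3) by (simp add: wle_def)
qed

text \<open>A join can lie strictly below the pointwise infimum because it is regularized from the
  right, so a member below \<open>c\<close> is found only at a later time. If there were none, the
  step from \<open>c\<close> down to 0 at \<open>t'\<close> would be an upper bound for \<preceq>
  with value \<open>c\<close> at \<open>t\<close>.\<close>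

lemma wJoin_less:
  assumes nonneg: "\<And>f t. f \<in> F \<Longrightarrow> t > 0 \<Longrightarrow> 0 \<le> f t"
    and anti: "\<And>f s t. f \<in> F \<Longrightarrow> 0 < s \<Longrightarrow> s \<le> t \<Longrightarrow> f t \<le> f s"
    and t: "0 < t" "t < t'" and less: "wJoin F t < c" and c: "c \<le> 1"
  shows "\<exists>f\<in>F. f t' < c"
proof (rule ccontr)
  assume "\<not> ?thesis"
  then have ge: "c \<le> f t'" if "f \<in> F" for f using that by force
  have W: "wJoin F \<in> W" by (rule wJoin_lub(1)) (rule nonneg)
  let ?\<sigma> = "\<lambda>t\<in>{0<..}. if t < t' then c else 0"
  have "0 \<le> c" using W_in[OF W t(1)] less by simp
  then have \<sigma>: "?\<sigma> \<in> W" using c by (intro step_in_W) auto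
  have "f \<preceq> ?\<sigma>" if "f \<in> F" for f
    unfolding wle_def
  proof (intro allI impI)
    fix s :: real assume "s > 0"
    then show "?\<sigma> s \<le> f s" using anti[OF that, of s t'] ge[OF that] nonneg[OF that, of s] by auto
  qed
  moreover from nonneg \<sigma> have "wJoin F \<preceq> ?\<sigma> \<longleftrightarrow> (\<forall>f\<in>F. f \<preceq> ?\<sigma>)"
    by (rule wJoin_lub(2))
  ultimately have "wJoin F \<preceq> ?\<sigma>" by blast
  then have "c \<le> wJoin F t" using t unfolding wle_def by (auto dest: spec[of _ t])
  then show False using less by simp
qed

section \<open>Algebra and limits of a continuous t-conorm\<close>

locale continuous_conorm =
  fixes S :: "real \<Rightarrow> real \<Rightarrow> real"
  assumes conorm: "continuous_tconorm S"
begin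

abbreviation I :: "real set" where "I \<equiv> {0..1}"

lemma S_in: "\<lbrakk>a \<in> I; b \<in> I\<rbrakk> \<Longrightarrow> S a b \<in> I"
  using conorm unfolding continuous_tconorm_def tconorm_def by blast

lemma S_comm: "\<lbrakk>a \<in> I; b \<in> I\<rbrakk> \<Longrightarrow> S a b = S b a"
  using conorm unfolding continuous_tconorm_def tconorm_def by blast

lemma S_assoc: "\<lbrakk>a \<in> I; b \<in> I; c \<in> I\<rbrakk> \<Longrightarrow> S (S a b) c = S a (S b c)"
  using conorm unfolding continuous_tconorm_def tconorm_def by blast

lemma S_mono: "\<lbrakk>a \<in> I; b \<in> I; a' \<in> I; b' \<in> I; a \<le> a'; b \<le> b'\<rbrakk> \<Longrightarrow> S a b \<le> S a' b'"
  using conorm unfolding continuous_tconorm_def tconorm_def by blast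

lemma S_0_right: "a \<in> I \<Longrightarrow> S a 0 = a"
  using conorm unfolding continuous_tconorm_def tconorm_def by blast

lemma S_0_left: "a \<in> I \<Longrightarrow> S 0 a = a"
  using S_0_right S_comm[of 0 a] by simp

lemma le_S_left: "\<lbrakk>a \<in> I; b \<in> I\<rbrakk> \<Longrightarrow> a \<le> S a b"
  using S_mono[of a 0 a b] S_0_right[of a] by simp

lemma le_S_right: "\<lbrakk>a \<in> I; b \<in> I\<rbrakk> \<Longrightarrow> b \<le> S a b"
  using le_S_left S_comm by metis

lemma S_1_left: "b \<in> I \<Longrightarrow> S 1 b = 1"
  using le_S_left[of 1 b] S_in[of 1 b] by simp

lemma S_left_commute: "\<lbrakk>a \<in> I; b \<in> I; c \<in> I\<rbrakk> \<Longrightarrow> S a (S b c) = S b (S a c)"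
  by (metis S_assoc S_comm)

lemma S_interchange:
  "\<lbrakk>a \<in> I; b \<in> I; c \<in> I; d \<in> I\<rbrakk> \<Longrightarrow> S (S a b) (S c d) = S (S a c) (S b d)"
  using S_assoc[of a b "S c d"] S_left_commute[of b c d] S_assoc[of a c "S b d"] S_in[of b d]
    S_in[of c d] by simp

lemma S_le_limit:
  assumes b: "b \<in> I" and c: "c \<in> I" and x: "x \<le> 1"
    and le: "\<And>c'. \<lbrakk>c < c'; c' \<le> 1\<rbrakk> \<Longrightarrow> x \<le> S c' b"
  shows "x \<le> S c b"
proof (cases "c = 1")
  \<comment> \<open>There is no \<open>c'\<close> between \<open>c\<close> and 1 in this case;
    instead 1 is absorbing and bounds \<open>x\<close>.\<close>
  case True
  then show ?thesis using S_1_left[OF b] x by simp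
next
  case False
  then have c1: "c < 1" using c by simp
  have "continuous_on {c..1} (\<lambda>a. (\<lambda>(a, b). S a b) (a, b))"
    by (rule continuous_on_compose2[where t = "{0..1} \<times> {0..1}"])
      (use conorm b c in \<open>auto simp: continuous_tconorm_def intro!: continuous_intros\<close>)
  then have "((\<lambda>a. S a b) \<longlongrightarrow> S c b) (at c within {c..1})"
    using c1 by (simp add: continuous_on_def)
  then have "((\<lambda>a. S a b) \<longlongrightarrow> S c b) (at_right c)"
    using c1 by (simp add: at_within_Icc_at_right)
  moreover have "eventually (\<lambda>a. x \<le> S a b) (at_right c)"
    using le c1 by (auto simp: eventually_at_right_field intro!: exI[of _ 1])
  ultimately show ?thesis by (rule tendsto_lowerbound) simp
qed

text \<open>Continuity along the diagonal at 0, where \<open>S 0 0 = 0\<close>. This replaces the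
  halving of \<epsilon> in metric arguments.\<close>

lemma S_small:
  assumes "\<eta> > 0"
  obtains \<epsilon> where "0 < \<epsilon>" "\<epsilon> < 1" "S \<epsilon> \<epsilon> < \<eta>"
proof -
  have "continuous_on {0..1} (\<lambda>a. (\<lambda>(a, b). S a b) (a, a))"
    by (rule continuous_on_compose2[where t = "{0..1} \<times> {0..1}"])
      (use conorm in \<open>auto simp: continuous_tconorm_def intro!: continuous_intros\<close>)
  then have "((\<lambda>a. S a a) \<longlongrightarrow> S 0 0) (at 0 within {0..1})"
    by (simp add: continuous_on_def)
  then have "((\<lambda>a. S a a) \<longlongrightarrow> 0) (at_right 0)"
    by (simp add: at_within_Icc_at_right S_0_left)
  then have "eventually (\<lambda>a. S a a < \<eta>) (at_right 0)"
    using assms by (rule order_tendstoD)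
  moreover have "eventually (\<lambda>a. a < (1::real)) (at_right 0)"
    by (auto simp: eventually_at_right_field intro!: exI[of _ 1])
  ultimately have "eventually (\<lambda>a. 0 < a \<and> a < 1 \<and> S a a < \<eta>) (at_right 0)"
    using eventually_at_right_less[of 0] by eventually_elim auto
  from eventually_happens[OF this] show thesis using that by auto
qed

text \<open>Removes an error in value and a delay in time together. The error has the form
  \<open>S \<epsilon> \<epsilon>\<close> because the approximation arguments below incur \<epsilon>
  twice.\<close>

lemma W_le_limit:
  assumes f: "f \<in> W" "t > 0" and b: "b \<in> I"
    and le: "\<And>\<epsilon> u. \<lbrakk>0 < \<epsilon>; \<epsilon> < 1; 0 < u\<rbrakk> \<Longrightarrow> f (t + u) \<le> S (S \<epsilon> \<epsilon>) b"
  shows "f t \<le> b"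
proof -
  have "f t \<le> S 0 b"
  proof (rule S_le_limit[OF b])
    fix c :: real assume c: "0 < c" "c \<le> 1"
    then obtain \<epsilon> where \<epsilon>: "0 < \<epsilon>" "\<epsilon> < 1" "S \<epsilon> \<epsilon> < c" using S_small by blast
    show "f t \<le> S c b"
    proof (rule W_right_limit_le[OF f])
      fix u :: real assume "u > 0"
      then have "f (t + u) \<le> S (S \<epsilon> \<epsilon>) b" using le \<epsilon> by blast
      also have "\<dots> \<le> S c b" by (rule S_mono) (use \<epsilon> c b S_in[of \<epsilon> \<epsilon>] in auto)
      finally show "f (t + u) \<le> S c b" .
    qed
  qed (use W_in[OF f] in auto)
  then show ?thesis using S_0_left[OF b] by simp
qed

section \<open>The convolution product and its residual\<close>

lemma wstar_le:
  assumes "\<phi> \<in> W" "\<psi> \<in> W" "0 < t" "0 < s"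
  shows "wstar S \<phi> \<psi> (t + s) \<le> S (\<phi> t) (\<psi> s)"
proof -
  have "bdd_below {S (\<phi> t') (\<psi> s') | t' s'. 0 < t' \<and> 0 < s' \<and> t + s = t' + s'}"
  proof (rule bdd_belowI)
    fix x assume "x \<in> {S (\<phi> t') (\<psi> s') | t' s'. 0 < t' \<and> 0 < s' \<and> t + s = t' + s'}"
    then show "0 \<le> x" using S_in[OF W_in[OF assms(1)] W_in[OF assms(2)]] by auto
  qed
  then have "Inf {S (\<phi> t') (\<psi> s') | t' s'. 0 < t' \<and> 0 < s' \<and> t + s = t' + s'} \<le> S (\<phi> t) (\<psi> s)"
    by (rule cInf_lower[rotated]) (use assms in blast)
  then show ?thesis using assms by (simp add: wstar_def)
qed

lemma wstar_ge:
  assumes u: "u > 0" and le: "\<And>t s. \<lbrakk>0 < t; 0 < s; u = t + s\<rbrakk> \<Longrightarrow> c \<le> S (\<phi> t) (\<psi> s)"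
  shows "c \<le> wstar S \<phi> \<psi> u"
proof -
  let ?V = "{S (\<phi> t) (\<psi> s) | t s. 0 < t \<and> 0 < s \<and> u = t + s}"
  \<comment> \<open>The set of splittings must be nonempty for its infimum to be a greatest lower
    bound.\<close>
  have "S (\<phi> (u / 2)) (\<psi> (u / 2)) \<in> ?V"
    using u by (intro CollectI exI[of _ "u / 2"]) simp
  then have "c \<le> Inf ?V" by (intro cInf_greatest) (use le in auto)
  then show ?thesis using u by (simp add: wstar_def)
qed

text \<open>Reduces an inequality for the product to a pointwise triangle inequality, the form in
  which the category and module axioms are used below.\<close>

lemma wstar_le_iff:
  assumes "\<phi> \<in> W" "\<psi> \<in> W"
  shows "wstar S \<phi> \<psi> \<preceq> \<theta> \<longleftrightarrow> (\<forall>t>0. \<forall>s>0. \<theta> (t + s) \<le> S (\<phi> t) (\<psi> s))"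
proof
  show "\<forall>t>0. \<forall>s>0. \<theta> (t + s) \<le> S (\<phi> t) (\<psi> s)" if "wstar S \<phi> \<psi> \<preceq> \<theta>"
  proof (intro allI impI)
    fix t s :: real assume "0 < t" "0 < s"
    then have "\<theta> (t + s) \<le> wstar S \<phi> \<psi> (t + s)" using that by (simp add: wle_def)
    also have "\<dots> \<le> S (\<phi> t) (\<psi> s)" by (rule wstar_le) fact+
    finally show "\<theta> (t + s) \<le> S (\<phi> t) (\<psi> s)" .
  qed
qed (auto simp: wle_def intro: wstar_ge)

lemma wstar_nonneg:
  assumes "\<phi> \<in> W" "\<psi> \<in> W" "u > 0"
  shows "0 \<le> wstar S \<phi> \<psi> u"
  using S_in[OF W_in[OF assms(1)] W_in[OF assms(2)]] assms(3) by (intro wstar_ge) auto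

lemma wstar_antimono:
  assumes W: "\<phi> \<in> W" "\<psi> \<in> W" and u: "0 < u" "u \<le> v"
  shows "wstar S \<phi> \<psi> v \<le> wstar S \<phi> \<psi> u"
proof (rule wstar_ge[OF u(1)])
  fix t s :: real assume ts: "0 < t" "0 < s" "u = t + s"
  \<comment> \<open>The additional time \<open>v - u\<close> is given to the second factor, whose
    value can only drop.\<close>
  have "wstar S \<phi> \<psi> (t + (v - t)) \<le> S (\<phi> t) (\<psi> (v - t))"
    by (rule wstar_le) (use W ts u in auto)
  also have "\<dots> \<le> S (\<phi> t) (\<psi> s)"
    by (intro S_mono W_in[OF W(1)] W_in[OF W(2)] W_antimono[OF W(2)]) (use ts u in auto)
  finally show "wstar S \<phi> \<psi> v \<le> S (\<phi> t) (\<psi> s)" by simp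
qed

lemma whom_in_W: "\<lbrakk>\<phi> \<in> W; \<psi> \<in> W\<rbrakk> \<Longrightarrow> whom S \<phi> \<psi> \<in> W"
  unfolding whom_def by (rule wJoin_lub(1)) (use W_in in auto)

text \<open>Forwards, any \<open>c' > c\<close> and any later time admit a member of the defining
  set below \<open>c'\<close>, and both slacks are then sent to zero. Backwards, a suitable step
  function belongs to that set.\<close>

lemma whom_le_iff:
  assumes W: "\<phi> \<in> W" "\<psi> \<in> W" and t: "t > 0" and c: "c \<in> I"
  shows "whom S \<phi> \<psi> t \<le> c \<longleftrightarrow> (\<forall>s>0. \<psi> (t + s) \<le> S c (\<phi> s))"
proof
  let ?F = "{\<theta> \<in> W. wstar S \<theta> \<phi> \<preceq> \<psi>}"
  have nonneg: "0 \<le> f t" if "f \<in> ?F" "t > 0" for f t using that W_in[of f t] by auto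
  show "\<forall>s>0. \<psi> (t + s) \<le> S c (\<phi> s)" if le: "whom S \<phi> \<psi> t \<le> c"
  proof (intro allI impI)
    fix s :: real assume s: "s > 0"
    show "\<psi> (t + s) \<le> S c (\<phi> s)"
    proof (rule S_le_limit[OF W_in[OF W(1) s] c])
      show "\<psi> (t + s) \<le> 1" using W_in[OF W(2), of "t + s"] s t by auto
      fix c' assume c': "c < c'" "c' \<le> 1"
      show "\<psi> (t + s) \<le> S c' (\<phi> s)"
      proof (rule W_right_limit_le[OF W(2)])
        fix u :: real assume u: "u > 0"
        have "\<exists>\<theta>\<in>?F. \<theta> (t + u) < c'"
        proof (rule wJoin_less[where t = t])
          show "wJoin ?F t < c'" using le c' by (simp add: whom_def)
        qed (use nonneg t u c' W_antimono in auto)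
        then obtain \<theta> where \<theta>: "\<theta> \<in> W" "wstar S \<theta> \<phi> \<preceq> \<psi>" "\<theta> (t + u) < c'" by blast
        have "\<psi> ((t + u) + s) \<le> S (\<theta> (t + u)) (\<phi> s)"
          using \<theta>(2) t u s unfolding wstar_le_iff[OF \<theta>(1) W(1)] by simp
        also have "\<dots> \<le> S c' (\<phi> s)"
          by (rule S_mono) (use \<theta> c' c W_in[OF \<theta>(1), of "t + u"] t u W_in[OF W(1) s] in auto)
        finally show "\<psi> (t + s + u) \<le> S c' (\<phi> s)" by (simp add: ac_simps)
      qed (use t s in simp)
    qed
  qed
  show "whom S \<phi> \<psi> t \<le> c" if le: "\<forall>s>0. \<psi> (t + s) \<le> S c (\<phi> s)"
  proof -
    \<comment> \<open>Before \<open>t\<close> the value 1 is absorbing and makes the condition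
      trivial; from \<open>t\<close> on the assumption at \<open>t\<close> suffices, since \<psi> is
      nonincreasing.\<close>
    let ?\<theta> = "\<lambda>r\<in>{0<..}. if r < t then 1 else c"
    have \<theta>: "?\<theta> \<in> W" using c by (intro step_in_W) auto
    have "\<psi> (r + s) \<le> S (?\<theta> r) (\<phi> s)" if rs: "r > 0" "s > 0" for r s
    proof (cases "r < t")
      case True
      then show ?thesis using rs W_in[OF W(2), of "r + s"] S_1_left[OF W_in[OF W(1) rs(2)]] by simp
    next
      case False
      then have "\<psi> (r + s) \<le> \<psi> (t + s)" using rs t by (intro W_antimono[OF W(2)]) auto
      also have "\<dots> \<le> S c (\<phi> s)" using le rs by blast
      finally show ?thesis using False rs by simp
    qed
    then have "wstar S ?\<theta> \<phi> \<preceq> \<psi>" unfolding wstar_le_iff[OF \<theta> W(1)] by blast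
    with \<theta> have "?\<theta> \<in> ?F" by blast
    with nonneg have "wJoin ?F t \<le> ?\<theta> t" using t by (rule wJoin_le)
    then show ?thesis using t by (simp add: whom_def)
  qed
qed

end

section \<open>The uniformity of an enriched category\<close>

text \<open>The nested infimum is flattened to one over pairs \<open>(r, t)\<close>. That family is
  directed, since taking the minimum in each coordinate refines two members, so it is a filter
  base.\<close>

lemma eventually_two_parameter_base:
  fixes E :: "real \<Rightarrow> real \<Rightarrow> 'b set"
  assumes mono: "\<And>r r' t t'. \<lbrakk>r \<le> r'; 0 < t; t \<le> t'\<rbrakk> \<Longrightarrow> E r t \<subseteq> E r' t'"
  shows "eventually P (INF r\<in>{0<..<1}. INF t\<in>{0<..}. principal (E r t)) \<longleftrightarrow>
    (\<exists>r t. 0 < r \<and> r < 1 \<and> 0 < t \<and> (\<forall>p\<in>E r t. P p))"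
proof -
  let ?B = "{0<..<(1::real)} \<times> {(0::real)<..}"
  have "(INF r\<in>{0<..<1}. INF t\<in>{0<..}. principal (E r t)) = (INF p\<in>?B. principal (E (fst p) (snd p)))"
  proof (rule antisym)
    show "(INF r\<in>{0<..<1}. INF t\<in>{0<..}. principal (E r t)) \<le> (INF p\<in>?B. principal (E (fst p) (snd p)))"
    proof (rule INF_greatest)
      fix p :: "real \<times> real" assume p: "p \<in> ?B"
      show "(INF r\<in>{0<..<1}. INF t\<in>{0<..}. principal (E r t)) \<le> principal (E (fst p) (snd p))"
        by (rule INF_lower2[of "fst p"], use p in force, rule INF_lower) (use p in force)
    qed
    show "(INF p\<in>?B. principal (E (fst p) (snd p))) \<le> (INF r\<in>{0<..<1}. INF t\<in>{0<..}. principal (E r t))"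
    proof (intro INF_greatest)
      fix r t :: real assume "r \<in> {0<..<1}" "t \<in> {0<..}"
      then show "(INF p\<in>?B. principal (E (fst p) (snd p))) \<le> principal (E r t)"
        by (intro INF_lower2[of "(r, t)"]) auto
    qed
  qed
  also have "eventually P \<dots> \<longleftrightarrow> (\<exists>p\<in>?B. eventually P (principal (E (fst p) (snd p))))"
  proof (rule eventually_INF_base)
    have "(1 / 2, 1) \<in> ?B" by simp
    then show "?B \<noteq> {}" by blast
    fix p q assume "p \<in> ?B" "q \<in> ?B"
    then have m: "(min (fst p) (fst q), min (snd p) (snd q)) \<in> ?B" and pos: "0 < snd p" "0 < snd q"
      by auto
    moreover have "E (min (fst p) (fst q)) (min (snd p) (snd q)) \<subseteq> E (fst p) (snd p)"
      "E (min (fst p) (fst q)) (min (snd p) (snd q)) \<subseteq> E (fst q) (snd q)"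
      by (rule mono; use pos in simp)+
    ultimately show "\<exists>x\<in>?B. principal (E (fst x) (snd x))
        \<le> inf (principal (E (fst p) (snd p))) (principal (E (fst q) (snd q)))"
      by (intro bexI[OF _ m]) simp
  qed
  also have "\<dots> \<longleftrightarrow> (\<exists>r t. 0 < r \<and> r < 1 \<and> 0 < t \<and> (\<forall>p\<in>E r t. P p))"
    by (auto simp: eventually_principal Bex_def)
  finally show ?thesis .
qed

lemma eventually_wcat_uniformity:
  assumes "wcategory S C"
  shows "eventually P (wcat_uniformity C) \<longleftrightarrow>
    (\<exists>r t. 0 < r \<and> r < 1 \<and> 0 < t \<and>
       (\<forall>a\<in>Ob C. \<forall>b\<in>Ob C. Hom C a b t < r \<longrightarrow> Hom C b a t < r \<longrightarrow> P (a, b)))"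
proof -
  let ?E = "\<lambda>r t. {(a, b). a \<in> Ob C \<and> b \<in> Ob C \<and> Hom C a b t < r \<and> Hom C b a t < r}"
  have "?E r t \<subseteq> ?E r' t'" if "r \<le> r'" "0 < t" "t \<le> t'" for r r' t t'
  proof -
    have "Hom C a b t' \<le> Hom C a b t" if "a \<in> Ob C" "b \<in> Ob C" for a b
    proof (rule W_antimono[of "Hom C a b"])
      show "Hom C a b \<in> W" using assms \<open>a \<in> Ob C\<close> \<open>b \<in> Ob C\<close> by (simp add: wcategory_def)
    qed fact+
    then show ?thesis using that(1) by (fastforce dest: le_less_trans)
  qed
  then have "eventually P (wcat_uniformity C) \<longleftrightarrow>
      (\<exists>r t. 0 < r \<and> r < 1 \<and> 0 < t \<and> (\<forall>p\<in>?E r t. P p))"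
    unfolding wcat_uniformity_def by (rule eventually_two_parameter_base)
  moreover have "(\<forall>p\<in>?E r t. P p) \<longleftrightarrow>
      (\<forall>a\<in>Ob C. \<forall>b\<in>Ob C. Hom C a b t < r \<longrightarrow> Hom C b a t < r \<longrightarrow> P (a, b))" for r t
    by auto
  ultimately show ?thesis by (simp only:)
qed

context continuous_conorm
begin

text \<open>For the composition axiom, time is split into two halves and the radius is shrunk to
  \<epsilon> with \<open>S \<epsilon> \<epsilon> < r\<close>.\<close>

lemma uniformity_carrier_wcat_uniformity:
  assumes C: "wcategory S C"
  shows "uniformity_carrier (Ob C) (wcat_uniformity C)"
  unfolding uniformity_carrier_def
proof (intro conjI allI impI)
  note ev = eventually_wcat_uniformity[OF C]
  have W: "Hom C a b \<in> W" if "a \<in> Ob C" "b \<in> Ob C" for a b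
    using C that by (simp add: wcategory_def)
  \<comment> \<open>Every basic entourage consists of pairs of objects; these parameters merely
    select one.\<close>
  have "0 < (1/2 :: real) \<and> (1/2 :: real) < 1 \<and> 0 < (1 :: real)" by simp
  then show "wcat_uniformity C \<le> principal (Ob C \<times> Ob C)"
    unfolding le_principal ev by blast
  fix E assume "eventually E (wcat_uniformity C)"
  then obtain r t where r: "0 < r" "r < 1" and t: "0 < t"
    and E: "\<And>a b. \<lbrakk>a \<in> Ob C; b \<in> Ob C; Hom C a b t < r; Hom C b a t < r\<rbrakk> \<Longrightarrow> E (a, b)"
    unfolding ev by blast
  show "\<forall>y\<in>Ob C. E (y, y)"
  proof
    fix y assume y: "y \<in> Ob C"
    then have "wunit \<preceq> Hom C y y" using C by (simp add: wcategory_def)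
    then have "Hom C y y t \<le> 0" using t by (simp add: wle_def wunit_def)
    then show "E (y, y)" using E y r by simp
  qed
  show "eventually (\<lambda>(x, y). E (y, x)) (wcat_uniformity C)"
    unfolding ev using r t E by auto
  obtain \<epsilon> where \<epsilon>: "0 < \<epsilon>" "\<epsilon> < 1" "S \<epsilon> \<epsilon> < r" using S_small r(1) by blast
  let ?D = "\<lambda>(a, b). Hom C a b (t / 2) < \<epsilon> \<and> Hom C b a (t / 2) < \<epsilon>"
  have "0 < t / 2" using t by simp
  then have "eventually ?D (wcat_uniformity C)" unfolding ev using \<epsilon>(1,2) by blast
  moreover have "E (x, z)"
    if xyz: "x \<in> Ob C" "y \<in> Ob C" "z \<in> Ob C" and D: "?D (x, y)" "?D (y, z)" for x y z
  proof -
    \<comment> \<open>An entourage bounds both hom-objects, so the estimate is used once along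
      \<open>x\<close>, \<open>y\<close>, \<open>z\<close> and once along \<open>z\<close>,
      \<open>y\<close>, \<open>x\<close>.\<close>
    have small: "Hom C a c t < r"
      if abc: "a \<in> Ob C" "b \<in> Ob C" "c \<in> Ob C" and "Hom C a b (t / 2) < \<epsilon>" "Hom C b c (t / 2) < \<epsilon>"
      for a b c
    proof -
      have "wstar S (Hom C a b) (Hom C b c) \<preceq> Hom C a c"
        using C abc by (simp add: wcategory_def)
      then have "Hom C a c (t / 2 + t / 2) \<le> S (Hom C a b (t / 2)) (Hom C b c (t / 2))"
        unfolding wstar_le_iff[OF W[OF abc(1,2)] W[OF abc(2,3)]] using t half_gt_zero by blast
      also have "\<dots> \<le> S \<epsilon> \<epsilon>"
        by (rule S_mono) (use that \<epsilon> t W_in[OF W[OF abc(1,2)], of "t / 2"]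
            W_in[OF W[OF abc(2,3)], of "t / 2"] in auto)
      finally show ?thesis using \<epsilon>(3) by simp
    qed
    show ?thesis using small[OF xyz] small[OF xyz(3,2,1)] D E xyz by simp
  qed
  ultimately show "\<exists>D. eventually D (wcat_uniformity C) \<and>
      (\<forall>x\<in>Ob C. \<forall>y\<in>Ob C. \<forall>z\<in>Ob C. D (x, y) \<longrightarrow> D (y, z) \<longrightarrow> E (x, z))"
    by blast
qed

end

section \<open>The Cauchy completion of a symmetric category\<close>

locale symmetric_wcategory = continuous_conorm S for S +
  fixes C :: "'a wcat"
  assumes wcat: "wcategory S C" and sym: "symmetric_wcat C"
begin

abbreviation d :: "'a \<Rightarrow> 'a \<Rightarrow> real \<Rightarrow> real" where "d \<equiv> Hom C"
abbreviation K where "K \<equiv> cauchy_completion S C"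

lemma d_W: "\<lbrakk>x \<in> Ob C; y \<in> Ob C\<rbrakk> \<Longrightarrow> d x y \<in> W"
  using wcat by (simp add: wcategory_def)

lemma d_in: "\<lbrakk>x \<in> Ob C; y \<in> Ob C; t > 0\<rbrakk> \<Longrightarrow> d x y t \<in> I"
  using W_in d_W by blast

lemma d_sym: "\<lbrakk>x \<in> Ob C; y \<in> Ob C\<rbrakk> \<Longrightarrow> d x y = d y x"
  using sym by (simp add: symmetric_wcat_def)

lemma d_refl: "\<lbrakk>x \<in> Ob C; t > 0\<rbrakk> \<Longrightarrow> d x x t = 0"
  using wcat d_in[of x x t] by (auto simp: wcategory_def wle_def wunit_def intro: antisym)

lemma d_triangle:
  "\<lbrakk>x \<in> Ob C; y \<in> Ob C; z \<in> Ob C; t > 0; s > 0\<rbrakk> \<Longrightarrow> d x z (t + s) \<le> S (d x y t) (d y z s)"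
  using wcat wstar_le_iff[OF d_W d_W] unfolding wcategory_def by blast

text \<open>
  The Cauchy modules of a symmetric category are those adjoint to their own transpose; the third
  clause is then the unit and the second one the counit of the adjunction.
\<close>

definition weight :: "('a \<Rightarrow> real \<Rightarrow> real) \<Rightarrow> bool" where
  "weight \<Phi> \<longleftrightarrow> \<Phi> \<in> Ob C \<rightarrow>\<^sub>E W \<and>
     (\<forall>x\<in>Ob C. \<forall>y\<in>Ob C. \<forall>t>0. \<forall>s>0. \<Phi> x (t + s) \<le> S (d x y t) (\<Phi> y s)) \<and>
     (\<forall>x\<in>Ob C. \<forall>y\<in>Ob C. \<forall>t>0. \<forall>s>0. d x y (t + s) \<le> S (\<Phi> x t) (\<Phi> y s)) \<and>
     (\<forall>\<epsilon>>0. \<forall>u>0. \<exists>x\<in>Ob C. \<Phi> x u < \<epsilon>)"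

lemma weight_W: "\<lbrakk>weight \<Phi>; x \<in> Ob C\<rbrakk> \<Longrightarrow> \<Phi> x \<in> W"
  unfolding weight_def by blast

lemma weight_in: "\<lbrakk>weight \<Phi>; x \<in> Ob C; t > 0\<rbrakk> \<Longrightarrow> \<Phi> x t \<in> I"
  using W_in weight_W by blast

lemma weight_module:
  "\<lbrakk>weight \<Phi>; x \<in> Ob C; y \<in> Ob C; t > 0; s > 0\<rbrakk> \<Longrightarrow> \<Phi> x (t + s) \<le> S (d x y t) (\<Phi> y s)"
  unfolding weight_def by blast

lemma weight_counit:
  "\<lbrakk>weight \<Phi>; x \<in> Ob C; y \<in> Ob C; t > 0; s > 0\<rbrakk> \<Longrightarrow> d x y (t + s) \<le> S (\<Phi> x t) (\<Phi> y s)"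
  unfolding weight_def by blast

lemma weight_unit: "\<lbrakk>weight \<Phi>; \<epsilon> > 0; u > 0\<rbrakk> \<Longrightarrow> \<exists>x\<in>Ob C. \<Phi> x u < \<epsilon>"
  unfolding weight_def by blast

section \<open>Adjoint modules between the one-object category and \<open>C\<close>\<close>

lemma wcategory_unit_wcat: "wcategory S unit_wcat"
proof -
  have "wstar S wunit wunit \<preceq> wunit"
    unfolding wstar_le_iff[OF wunit_in_W wunit_in_W] using S_0_left[of 0] by (simp add: wunit_def)
  then show ?thesis by (simp add: wcategory_def unit_wcat_def wunit_in_W wle_def)
qed

text \<open>Makes the action of the one-object category automatic, so that only the action of
  \<open>C\<close> remains in the module axioms.\<close>

lemma wstar_wunit_le:
  assumes "\<phi> \<in> W"
  shows "wstar S \<phi> wunit \<preceq> \<phi>" "wstar S wunit \<phi> \<preceq> \<phi>"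
  unfolding wstar_le_iff[OF assms wunit_in_W] wstar_le_iff[OF wunit_in_W assms]
  using W_in[OF assms] W_antimono[OF assms]
  by (auto simp: wunit_def S_0_left S_0_right)

lemma wmodule_from_unit_iff:
  "wmodule S unit_wcat C M \<longleftrightarrow>
     (\<forall>x\<in>Ob C. M x () \<in> W) \<and>
     (\<forall>x\<in>Ob C. \<forall>y\<in>Ob C. \<forall>t>0. \<forall>s>0. M x () (t + s) \<le> S (d x y t) (M y () s))"
  using wcategory_unit_wcat wcat wstar_wunit_le(1)
  by (auto simp: wmodule_def unit_wcat_def wstar_le_iff d_W)

lemma wmodule_to_unit_iff:
  "wmodule S C unit_wcat N \<longleftrightarrow>
     (\<forall>x\<in>Ob C. N () x \<in> W) \<and>
     (\<forall>x\<in>Ob C. \<forall>y\<in>Ob C. \<forall>t>0. \<forall>s>0. N () y (t + s) \<le> S (N () x t) (d x y s))"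
  using wcategory_unit_wcat wcat wstar_wunit_le(2)
  by (auto simp: wmodule_def unit_wcat_def wstar_le_iff d_W)

text \<open>The join vanishes at all times iff its members become arbitrarily small at every time. A
  value of \<open>S\<close> bounds both of its arguments, and conversely
  \<open>S \<epsilon> \<epsilon>\<close> is small when \<epsilon> is.\<close>

lemma wunit_le_comp_iff:
  assumes M: "\<And>x. x \<in> Ob C \<Longrightarrow> M x () \<in> W" and N: "\<And>x. x \<in> Ob C \<Longrightarrow> N () x \<in> W"
  shows "wunit \<preceq> wmodule_comp S C N M () () \<longleftrightarrow>
    (\<forall>\<epsilon>>0. \<forall>u>0. \<exists>x\<in>Ob C. N () x u < \<epsilon> \<and> M x () u < \<epsilon>)"
proof -
  let ?F = "(\<lambda>x. wstar S (N () x) (M x ())) ` Ob C"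
  have nonneg: "0 \<le> f t" if "f \<in> ?F" "t > 0" for f t
    using that M N wstar_nonneg by auto
  have anti: "f t \<le> f s" if "f \<in> ?F" "0 < s" "s \<le> t" for f s t
    using that M N wstar_antimono by auto
  show ?thesis
  proof
    assume "wunit \<preceq> wmodule_comp S C N M () ()"
    then have le0: "wJoin ?F u \<le> 0" if "u > 0" for u
      using that by (simp add: wle_def wunit_def wmodule_comp_def)
    show "\<forall>\<epsilon>>0. \<forall>u>0. \<exists>x\<in>Ob C. N () x u < \<epsilon> \<and> M x () u < \<epsilon>"
    proof (intro allI impI)
      fix \<epsilon> u :: real assume \<epsilon>: "\<epsilon> > 0" and u: "u > 0"
      \<comment> \<open>The minimum with 1 meets the bound \<open>c \<le> 1\<close> in
        \<open>wJoin_less\<close>, and \<open>u / 2\<close> is an earlier time as that lemma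
        requires.\<close>
      have "\<exists>f\<in>?F. f u < min \<epsilon> 1"
        by (rule wJoin_less[where t = "u / 2"]) (use nonneg anti u le0[of "u / 2"] \<epsilon> in auto)
      then obtain x where x: "x \<in> Ob C" "wstar S (N () x) (M x ()) u < min \<epsilon> 1" by blast
      then obtain t s where ts: "0 < t" "0 < s" "u = t + s" "S (N () x t) (M x () s) < min \<epsilon> 1"
        using wstar_ge[OF u, of "min \<epsilon> 1" "N () x" "M x ()"] by (meson not_le)
      \<comment> \<open>Both factors move from \<open>t\<close> and \<open>s\<close> to the common
        later time \<open>u\<close> without increasing.\<close>
      have "N () x u \<le> N () x t" "M x () u \<le> M x () s"
        using ts W_antimono[OF N[OF x(1)]] W_antimono[OF M[OF x(1)]] by auto
      moreover have "N () x t \<le> S (N () x t) (M x () s)" "M x () s \<le> S (N () x t) (M x () s)"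
        using W_in[OF N[OF x(1)] ts(1)] W_in[OF M[OF x(1)] ts(2)] le_S_left le_S_right by blast+
      ultimately show "\<exists>x\<in>Ob C. N () x u < \<epsilon> \<and> M x () u < \<epsilon>"
        using x(1) ts(4) by (intro bexI[of _ x]) auto
    qed
  next
    assume small: "\<forall>\<epsilon>>0. \<forall>u>0. \<exists>x\<in>Ob C. N () x u < \<epsilon> \<and> M x () u < \<epsilon>"
    have "wJoin ?F u \<le> 0" if u: "u > 0" for u
    proof (rule field_le_epsilon)
      fix \<eta> :: real assume "\<eta> > 0"
      then obtain \<epsilon> where \<epsilon>: "0 < \<epsilon>" "\<epsilon> < 1" "S \<epsilon> \<epsilon> < \<eta>" using S_small by blast
      have u2: "u / 2 > 0" using u by simp
      obtain x where x: "x \<in> Ob C" "N () x (u / 2) < \<epsilon>" "M x () (u / 2) < \<epsilon>"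
        using small \<epsilon>(1) u2 by blast
      have "wJoin ?F u \<le> wstar S (N () x) (M x ()) u"
        by (rule wJoin_le) (use nonneg x u in auto)
      also have "\<dots> \<le> S (N () x (u / 2)) (M x () (u / 2))"
        using wstar_le[OF N[OF x(1)] M[OF x(1)] u2 u2] by simp
      also have "\<dots> \<le> S \<epsilon> \<epsilon>"
        by (rule S_mono) (use W_in[OF N[OF x(1)] u2] W_in[OF M[OF x(1)] u2] x \<epsilon> in auto)
      finally show "wJoin ?F u \<le> 0 + \<eta>" using \<epsilon>(3) by simp
    qed
    then show "wunit \<preceq> wmodule_comp S C N M () ()"
      by (simp add: wle_def wunit_def wmodule_comp_def)
  qed
qed

text \<open>The counit passes through the only object of \<open>unit_wcat\<close>, so its join has a
  single member; by the universal property of the join it amounts to an inequality for the bare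
  product.\<close>

lemma wmodule_adjoint_iff:
  "wmodule_adjoint S unit_wcat C M N \<longleftrightarrow>
     wmodule S unit_wcat C M \<and> wmodule S C unit_wcat N \<and>
     (\<forall>\<epsilon>>0. \<forall>u>0. \<exists>x\<in>Ob C. N () x u < \<epsilon> \<and> M x () u < \<epsilon>) \<and>
     (\<forall>x\<in>Ob C. \<forall>y\<in>Ob C. \<forall>t>0. \<forall>s>0. d x y (t + s) \<le> S (M x () t) (N () y s))"
proof (cases "wmodule S unit_wcat C M \<and> wmodule S C unit_wcat N")
  case True
  then have M: "\<And>x. x \<in> Ob C \<Longrightarrow> M x () \<in> W" and N: "\<And>x. x \<in> Ob C \<Longrightarrow> N () x \<in> W"
    unfolding wmodule_from_unit_iff wmodule_to_unit_iff by blast+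
  have "wmodule_comp S unit_wcat M N x y \<preceq> d x y \<longleftrightarrow>
      (\<forall>t>0. \<forall>s>0. d x y (t + s) \<le> S (M x () t) (N () y s))" if xy: "x \<in> Ob C" "y \<in> Ob C" for x y
  proof -
    have "wmodule_comp S unit_wcat M N x y \<preceq> d x y \<longleftrightarrow> (\<forall>\<phi>\<in>{wstar S (M x ()) (N () y)}. \<phi> \<preceq> d x y)"
      unfolding wmodule_comp_def unit_wcat_def wcat.simps UNIV_unit image_insert image_empty
      by (rule wJoin_lub(2)) (use M N xy wstar_nonneg d_W in auto)
    then show ?thesis using wstar_le_iff[OF M[OF xy(1)] N[OF xy(2)]] by simp
  qed
  with True show ?thesis
    using wunit_le_comp_iff[of M N, OF M N]
    by (simp add: wmodule_adjoint_def unit_wcat_def)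
next
  case False
  then show ?thesis by (auto simp: wmodule_adjoint_def)
qed

text \<open>Choose \<open>z\<close> where \<open>N\<close> (or \<open>M\<close>) is below
  \<epsilon>. The action of \<open>C\<close> leads from \<open>x\<close> to \<open>z\<close>, and
  symmetry of \<open>d\<close> lets the counit lead back, so each of \<open>M x\<close> and
  \<open>N x\<close> is bounded by the other with \<epsilon> added twice and a delay
  \<open>u\<close>.\<close>

lemma right_adjoint_unique:
  assumes adj: "wmodule_adjoint S unit_wcat C M N" and x: "x \<in> Ob C"
  shows "N () x = M x ()"
proof -
  have mods: "wmodule S unit_wcat C M" "wmodule S C unit_wcat N"
    and unit: "\<forall>\<epsilon>>0. \<forall>u>0. \<exists>x\<in>Ob C. N () x u < \<epsilon> \<and> M x () u < \<epsilon>"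
    and counit: "\<forall>x\<in>Ob C. \<forall>y\<in>Ob C. \<forall>t>0. \<forall>s>0. d x y (t + s) \<le> S (M x () t) (N () y s)"
    using adj unfolding wmodule_adjoint_iff by - (elim conjE, assumption)+
  have M: "M x () \<in> W" if "x \<in> Ob C" for x
    using mods(1) that unfolding wmodule_from_unit_iff by blast
  have M': "M x () (t + s) \<le> S (d x y t) (M y () s)"
    if "x \<in> Ob C" "y \<in> Ob C" "t > 0" "s > 0" for x y t s
    using mods(1) that unfolding wmodule_from_unit_iff by blast
  have N: "N () x \<in> W" if "x \<in> Ob C" for x
    using mods(2) that unfolding wmodule_to_unit_iff by blast
  have N': "N () y (t + s) \<le> S (N () x t) (d x y s)"
    if "x \<in> Ob C" "y \<in> Ob C" "t > 0" "s > 0" for x y t s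
    using mods(2) that unfolding wmodule_to_unit_iff by blast
  note Min = W_in[OF M] and Nin = W_in[OF N]
  have "N () x t = M x () t" if t: "t > 0" for t
  proof (rule antisym)
    show "N () x t \<le> M x () t"
    proof (rule W_le_limit[OF N[OF x] t Min[OF x t]])
      fix \<epsilon> u :: real assume \<epsilon>: "0 < \<epsilon>" "\<epsilon> < 1" and u: "0 < u"
      let ?u = "u / 2"
      have u2: "?u > 0" using u by simp
      obtain z where z: "z \<in> Ob C" "N () z ?u < \<epsilon>" using unit \<epsilon>(1) u2 by blast
      have "N () x (?u + (t + ?u)) \<le> S (N () z ?u) (d z x (t + ?u))"
        by (rule N') (use z x u t in auto)
      also have "d z x (t + ?u) = d x z (t + ?u)" using d_sym x z by simp
      also have "S (N () z ?u) (d x z (t + ?u)) \<le> S (N () z ?u) (S (M x () t) (N () z ?u))"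
        by (rule S_mono[OF Nin[OF z(1) u2] d_in[OF x z(1)] Nin[OF z(1) u2] S_in[OF Min[OF x t] Nin[OF z(1) u2]]])
          (use counit x z u t in auto)
      also have "\<dots> \<le> S \<epsilon> (S (M x () t) \<epsilon>)"
        by (intro S_mono S_in Nin[OF z(1) u2] Min[OF x t]) (use z \<epsilon> in auto)
      also have "\<dots> = S (S \<epsilon> \<epsilon>) (M x () t)"
        using S_comm[OF Min[OF x t], of \<epsilon>] S_assoc[of \<epsilon> \<epsilon> "M x () t"] \<epsilon> Min[OF x t] by simp
      also have "?u + (t + ?u) = t + u" by simp
      finally show "N () x (t + u) \<le> S (S \<epsilon> \<epsilon>) (M x () t)" .
    qed
    show "M x () t \<le> N () x t"
    proof (rule W_le_limit[OF M[OF x] t Nin[OF x t]])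
      fix \<epsilon> u :: real assume \<epsilon>: "0 < \<epsilon>" "\<epsilon> < 1" and u: "0 < u"
      let ?u = "u / 2"
      have u2: "?u > 0" using u by simp
      obtain z where z: "z \<in> Ob C" "M z () ?u < \<epsilon>" using unit \<epsilon>(1) u2 by blast
      have "M x () ((?u + t) + ?u) \<le> S (d x z (?u + t)) (M z () ?u)"
        by (rule M') (use z x u t in auto)
      also have "d x z (?u + t) = d z x (?u + t)" using d_sym x z by simp
      also have "S (d z x (?u + t)) (M z () ?u) \<le> S (S (M z () ?u) (N () x t)) (M z () ?u)"
        by (rule S_mono[OF d_in[OF z(1) x] Min[OF z(1) u2] S_in[OF Min[OF z(1) u2] Nin[OF x t]] Min[OF z(1) u2]])
          (use counit x z u t in auto)
      also have "\<dots> \<le> S (S \<epsilon> (N () x t)) \<epsilon>"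
        by (intro S_mono S_in Min[OF z(1) u2] Nin[OF x t]) (use z \<epsilon> in auto)
      also have "\<dots> = S (S \<epsilon> \<epsilon>) (N () x t)"
        using S_comm[OF Nin[OF x t], of \<epsilon>] S_assoc[of \<epsilon> "N () x t" \<epsilon>] S_assoc[of \<epsilon> \<epsilon> "N () x t"]
          \<epsilon> Nin[OF x t] by simp
      also have "?u + t + ?u = t + u" by simp
      finally show "M x () (t + u) \<le> S (S \<epsilon> \<epsilon>) (N () x t)" .
    qed
  qed
  then show ?thesis by (rule W_eqI[OF N[OF x] M[OF x]])
qed

lemma Ob_K: "\<Phi> \<in> Ob K \<longleftrightarrow> weight \<Phi>"
proof
  assume "\<Phi> \<in> Ob K"
  then obtain N where \<Phi>: "\<Phi> \<in> Ob C \<rightarrow>\<^sub>E W" and adj: "wmodule_adjoint S unit_wcat C (\<lambda>a _. \<Phi> a) N"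
    by (auto simp: cauchy_completion_def presheaf_cat_def)
  from right_adjoint_unique[OF adj] have "N () x = \<Phi> x" if "x \<in> Ob C" for x using that by simp
  with \<Phi> adj show "weight \<Phi>"
    unfolding wmodule_adjoint_iff wmodule_from_unit_iff weight_def by simp
next
  assume \<Phi>: "weight \<Phi>"
  have "wmodule S unit_wcat C (\<lambda>a _. \<Phi> a)"
    using \<Phi> by (simp add: wmodule_from_unit_iff weight_W weight_module)
  \<comment> \<open>Symmetry of \<open>d\<close> and commutativity of \<open>S\<close> turn the left
    action on \<Phi> into the right action required of its transpose.\<close>
  moreover have "\<Phi> y (t + s) \<le> S (\<Phi> x t) (d x y s)"
    if "x \<in> Ob C" "y \<in> Ob C" "t > 0" "s > 0" for x y t s
    using weight_module[OF \<Phi>, of y x s t] that d_sym[of x y] S_comm[OF d_in[of x y s] weight_in[OF \<Phi>, of x t]]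
    by (simp add: add.commute)
  then have "wmodule S C unit_wcat (\<lambda>_ a. \<Phi> a)"
    using \<Phi> by (simp add: wmodule_to_unit_iff weight_W)
  ultimately have "wmodule_adjoint S unit_wcat C (\<lambda>a _. \<Phi> a) (\<lambda>_ a. \<Phi> a)"
    unfolding wmodule_adjoint_iff using weight_unit[OF \<Phi>] weight_counit[OF \<Phi>] by blast
  then show "\<Phi> \<in> Ob K"
    using \<Phi> by (auto simp: cauchy_completion_def presheaf_cat_def wmodule_adjoint_def weight_def)
qed

section \<open>Hom-objects of the Cauchy completion\<close>

lemma Hom_K: "Hom K \<Phi> \<Psi> = wMeet ((\<lambda>a. whom S (\<Phi> a) (\<Psi> a)) ` Ob C)"
  by (simp add: cauchy_completion_def presheaf_cat_def)

lemma Hom_K_W: "\<lbrakk>weight \<Phi>; weight \<Psi>\<rbrakk> \<Longrightarrow> Hom K \<Phi> \<Psi> \<in> W"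
  unfolding Hom_K by (rule wMeet_glb(1)) (auto intro: whom_in_W weight_W)

lemma Hom_K_in: "\<lbrakk>weight \<Phi>; weight \<Psi>; t > 0\<rbrakk> \<Longrightarrow> Hom K \<Phi> \<Psi> t \<in> I"
  using Hom_K_W W_in by blast

lemma Hom_K_le_iff:
  assumes "weight \<Phi>" "weight \<Psi>" "t > 0" "c \<in> I"
  shows "Hom K \<Phi> \<Psi> t \<le> c \<longleftrightarrow> (\<forall>a\<in>Ob C. \<forall>s>0. \<Psi> a (t + s) \<le> S c (\<Phi> a s))"
proof -
  have "Hom K \<Phi> \<Psi> t \<le> c \<longleftrightarrow> (\<forall>f\<in>(\<lambda>a. whom S (\<Phi> a) (\<Psi> a)) ` Ob C. f t \<le> c)"
    unfolding Hom_K by (rule wMeet_le_iff) (use assms in \<open>auto intro: whom_in_W weight_W\<close>)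
  then show ?thesis using assms by (simp add: whom_le_iff[OF weight_W weight_W])
qed

text \<open>The value of the hom-object is itself an admissible \<open>c\<close> in
  \<open>Hom_K_le_iff\<close>.\<close>

lemma Hom_K_le:
  "\<lbrakk>weight \<Phi>; weight \<Psi>; a \<in> Ob C; t > 0; s > 0\<rbrakk> \<Longrightarrow> \<Psi> a (t + s) \<le> S (Hom K \<Phi> \<Psi> t) (\<Phi> a s)"
  using Hom_K_le_iff[of \<Phi> \<Psi> t "Hom K \<Phi> \<Psi> t"] Hom_K_in[of \<Phi> \<Psi> t] by blast

lemma wcategory_K: "wcategory S K"
  unfolding wcategory_def Ob_K
proof (intro conjI ballI)
  fix \<Phi> \<Psi> \<Omega> assume "\<Phi> \<in> Ob K" "\<Psi> \<in> Ob K" "\<Omega> \<in> Ob K"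
  then have weights: "weight \<Phi>" "weight \<Psi>" "weight \<Omega>" by (simp_all add: Ob_K)
  show "Hom K \<Phi> \<Psi> \<in> W" by (rule Hom_K_W) fact+
  have "Hom K \<Phi> \<Omega> (t + s) \<le> S (Hom K \<Phi> \<Psi> t) (Hom K \<Psi> \<Omega> s)" if ts: "t > 0" "s > 0" for t s
  proof -
    let ?p = "Hom K \<Phi> \<Psi> t" and ?q = "Hom K \<Psi> \<Omega> s"
    have pq: "?p \<in> I" "?q \<in> I" using Hom_K_in weights ts by blast+
    \<comment> \<open>By \<open>Hom_K_le_iff\<close> the triangle inequality follows once
      \<open>S ?p ?q\<close> is an admissible bound from \<Phi> to \<Omega>, and this is checked
      through \<Psi>.\<close>
    have "\<Omega> a ((t + s) + r) \<le> S (S ?p ?q) (\<Phi> a r)" if a: "a \<in> Ob C" and r: "r > 0" for a r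
    proof -
      have in01: "\<Psi> a (t + r) \<in> I" "\<Phi> a r \<in> I" using weights weight_in a ts r by auto
      have "\<Omega> a (s + (t + r)) \<le> S ?q (\<Psi> a (t + r))"
        by (rule Hom_K_le) (use weights a ts r in auto)
      also have "\<dots> \<le> S ?q (S ?p (\<Phi> a r))"
        by (rule S_mono[OF pq(2) in01(1) pq(2) S_in[OF pq(1) in01(2)]])
          (use Hom_K_le weights a ts r in auto)
      also have "\<dots> = S (S ?p ?q) (\<Phi> a r)"
        using S_left_commute S_assoc pq in01 by metis
      finally show ?thesis by (simp add: ac_simps)
    qed
    then show ?thesis
      using Hom_K_le_iff[OF weights(1,3), of "t + s" "S ?p ?q"] S_in[OF pq] ts by simp
  qed
  then show "wstar S (Hom K \<Phi> \<Psi>) (Hom K \<Psi> \<Omega>) \<preceq> Hom K \<Phi> \<Omega>"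
    using weights by (simp add: wstar_le_iff Hom_K_W)
  have "Hom K \<Phi> \<Phi> t \<le> 0" if t: "t > 0" for t
  proof -
    have "\<Phi> a (t + s) \<le> S 0 (\<Phi> a s)" if "a \<in> Ob C" "s > 0" for a s
      using W_antimono[OF weight_W, of \<Phi> a s "t + s"] S_0_left[OF weight_in] weights that t by simp
    then show ?thesis using Hom_K_le_iff[of \<Phi> \<Phi> t 0] weights t by simp
  qed
  then show "wunit \<preceq> Hom K \<Phi> \<Phi>" by (simp add: wle_def wunit_def)
qed

end

section \<open>Separatedness and completeness of the Cauchy completion\<close>

context symmetric_wcategory
begin

lemma separated_K: "separated_uniformity (Ob K) (wcat_uniformity K)"
  unfolding separated_uniformity_def
proof (intro ballI impI)
  fix \<Phi> \<Psi> assume "\<Phi> \<in> Ob K" "\<Psi> \<in> Ob K"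
    and close: "\<forall>E. eventually E (wcat_uniformity K) \<longrightarrow> E (\<Phi>, \<Psi>)"
  then have weights: "weight \<Phi>" "weight \<Psi>" by (simp_all add: Ob_K)
  have small: "Hom K \<Phi> \<Psi> t < r \<and> Hom K \<Psi> \<Phi> t < r" if "0 < r" "r < 1" "0 < t" for r t
  proof -
    have "eventually (\<lambda>(a, b). Hom K a b t < r \<and> Hom K b a t < r) (wcat_uniformity K)"
      unfolding eventually_wcat_uniformity[OF wcategory_K] using that by blast
    with close show ?thesis by blast
  qed
  have le: "\<Omega>' a s \<le> \<Omega> a s"
    if \<Omega>: "weight \<Omega>" "weight \<Omega>'" and small: "\<And>r t. \<lbrakk>0 < r; r < 1; 0 < t\<rbrakk> \<Longrightarrow> Hom K \<Omega> \<Omega>' t < r"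
      and a: "a \<in> Ob C" and s: "s > 0" for \<Omega> \<Omega>' a s
  proof (rule W_right_limit_le[OF weight_W[OF \<Omega>(2) a] s])
    fix u :: real assume u: "u > 0"
    have "Hom K \<Omega> \<Omega>' u \<le> 0"
    proof (rule ccontr)
      assume "\<not> ?thesis"
      \<comment> \<open>The instance \<open>r = 1 / 2\<close> shows that the hom value is below 1,
        so that this value may itself be taken as \<open>r\<close>.\<close>
      then show False using small[of "1 / 2" u] small[of "Hom K \<Omega> \<Omega>' u" u] u by simp
    qed
    then have "\<Omega>' a (u + s) \<le> S 0 (\<Omega> a s)"
      using Hom_K_le_iff[OF \<Omega> u, of 0] a s by simp
    then show "\<Omega>' a (s + u) \<le> \<Omega> a s"
      using S_0_left[OF weight_in[OF \<Omega>(1) a s]] by (simp add: add.commute)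
  qed
  have "\<Phi> a = \<Psi> a" if a: "a \<in> Ob C" for a
  proof (rule W_eqI)
    fix t :: real assume "t > 0"
    then show "\<Phi> a t = \<Psi> a t"
      using le[of \<Phi> \<Psi> a t] le[of \<Psi> \<Phi> a t] small weights a by force
  qed (use weights a weight_W in auto)
  moreover have "\<Phi> \<in> extensional (Ob C)" "\<Psi> \<in> extensional (Ob C)"
    using weights by (auto simp: weight_def PiE_iff)
  ultimately show "\<Phi> = \<Psi>" by (intro extensionalityI[of \<Phi> "Ob C" \<Psi>]) auto
qed

text \<open>Closeness to \<Psi> is expressed by the inequalities behind \<open>Hom_K_le_iff\<close>,
  because \<Psi> is not yet known to be a weight. They hold uniformly in \<open>a\<close> and
  \<open>s\<close>, since the Cauchy condition bounds hom-objects and these are suprema over all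
  objects.\<close>

lemma weight_limit:
  assumes F: "F \<noteq> bot" "F \<le> principal (Ob K)" and cauchy: "F \<times>\<^sub>F F \<le> wcat_uniformity K"
  obtains \<Psi> where "\<Psi> \<in> Ob C \<rightarrow>\<^sub>E W"
    "\<And>\<epsilon> u. \<lbrakk>0 < \<epsilon>; \<epsilon> < 1; 0 < u\<rbrakk> \<Longrightarrow> eventually (\<lambda>\<Phi>. weight \<Phi> \<and> (\<forall>a\<in>Ob C. \<forall>s>0.
       \<Psi> a (u + s) \<le> S \<epsilon> (\<Phi> a s) \<and> \<Phi> a (u + s) \<le> S \<epsilon> (\<Psi> a s))) F"
proof -
  text \<open>\<open>G a t\<close> is the upper limit of \<open>\<Phi> a t\<close> along \<open>F\<close>; \<open>wJoin\<close> makes it right-continuous.\<close>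
  define G where "G a t = Inf {c \<in> I. eventually (\<lambda>\<Phi>. \<Phi> a t \<le> c) F}" for a t
  define \<Psi> where "\<Psi> = (\<lambda>a\<in>Ob C. wJoin {G a})"
  have weights: "eventually weight F"
    using F(2) Ob_K by (simp add: le_principal)
  have bdd: "bdd_below {c \<in> I. eventually (\<lambda>\<Phi>. \<Phi> a t \<le> c) F}" for a t
    by (rule bdd_belowI[of _ 0]) auto
  have one: "1 \<in> {c \<in> I. eventually (\<lambda>\<Phi>. \<Phi> a t \<le> c) F}" if "a \<in> Ob C" "t > 0" for a t
  proof -
    from weights have "eventually (\<lambda>\<Phi>. \<Phi> a t \<le> 1) F"
      by eventually_elim (use that weight_in in auto)
    then show ?thesis by simp
  qed
  have G_le: "G a t \<le> c" if "c \<in> I" "eventually (\<lambda>\<Phi>. \<Phi> a t \<le> c) F" for a t c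
    unfolding G_def using that bdd by (intro cInf_lower) auto
  have G_in: "G a t \<in> I" if "a \<in> Ob C" "t > 0" for a t
  proof -
    have "0 \<le> G a t" unfolding G_def
      by (rule cInf_greatest) (use one[OF that] in auto)
    moreover have "G a t \<le> 1" by (rule G_le) (use one[OF that] in auto)
    ultimately show ?thesis by simp
  qed
  have G_less: "eventually (\<lambda>\<Phi>. \<Phi> a t \<le> c) F" if a: "a \<in> Ob C" and t: "t > 0" and less: "G a t < c" for a t c
  proof -
    have "{c \<in> I. eventually (\<lambda>\<Phi>. \<Phi> a t \<le> c) F} \<noteq> {}" using one[OF a t] by blast
    from cInf_lessD[OF this less[unfolded G_def]]
    obtain c' where c': "c' < c" "eventually (\<lambda>\<Phi>. \<Phi> a t \<le> c') F" by blast
    from c'(2) show ?thesis by eventually_elim (use c'(1) in simp)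
  qed
  have G_anti: "G a t \<le> G a s" if "a \<in> Ob C" "0 < s" "s \<le> t" for a s t
    unfolding G_def[of a s]
  proof (rule cInf_greatest)
    show "{c \<in> I. eventually (\<lambda>\<Phi>. \<Phi> a s \<le> c) F} \<noteq> {}" using one[OF that(1,2)] by blast
    fix c assume c: "c \<in> {c \<in> I. eventually (\<lambda>\<Phi>. \<Phi> a s \<le> c) F}"
    then have "eventually (\<lambda>\<Phi>. \<Phi> a s \<le> c) F" by simp
    with weights have "eventually (\<lambda>\<Phi>. \<Phi> a t \<le> c) F"
    proof eventually_elim
      case (elim \<Phi>)
      then show ?case using W_antimono[OF weight_W, of \<Phi> a s t] that by simp
    qed
    then show "G a t \<le> c" using c by (intro G_le) auto
  qed
  have \<Psi>_W: "\<Psi> a \<in> W" if "a \<in> Ob C" for a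
  proof -
    have "wJoin {G a} \<in> W" by (rule wJoin_lub(1)) (use G_in that in auto)
    then show ?thesis using that by (simp add: \<Psi>_def)
  qed
  have \<Psi>_le: "\<Psi> a t \<le> G a t" if "a \<in> Ob C" "t > 0" for a t
  proof -
    have "wJoin {G a} t \<le> G a t" by (rule wJoin_le) (use G_in that in auto)
    then show ?thesis using that by (simp add: \<Psi>_def)
  qed
  \<comment> \<open>With \<open>\<Psi>_le\<close> this sandwiches the regularization: passing from
    \<open>G\<close> to \<Psi> costs only an arbitrarily small delay.\<close>
  have le_\<Psi>: "G a t' \<le> \<Psi> a t" if a: "a \<in> Ob C" and t: "0 < t" "t < t'" for a t t'
  proof (rule ccontr)
    assume "\<not> ?thesis"
    then have "wJoin {G a} t < G a t'" using a by (simp add: \<Psi>_def)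
    then have "\<exists>f\<in>{G a}. f t' < G a t'"
      by (intro wJoin_less[OF _ _ t]) (use G_in[OF a] G_anti[OF a] t in auto)
    then show False by simp
  qed
  have "eventually (\<lambda>\<Phi>. weight \<Phi> \<and> (\<forall>a\<in>Ob C. \<forall>s>0.
      \<Psi> a (u + s) \<le> S \<epsilon> (\<Phi> a s) \<and> \<Phi> a (u + s) \<le> S \<epsilon> (\<Psi> a s))) F"
    if \<epsilon>: "0 < \<epsilon>" "\<epsilon> < 1" and u: "0 < u" for \<epsilon> u
  proof -
    let ?u = "u / 2"
    have u2: "?u > 0" using u by simp
    have \<epsilon>I: "\<epsilon> \<in> I" using \<epsilon> by simp
    have "eventually (\<lambda>(\<Phi>, \<Phi>'). Hom K \<Phi> \<Phi>' ?u < \<epsilon>) (wcat_uniformity K)"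
      unfolding eventually_wcat_uniformity[OF wcategory_K] using \<epsilon> u2 by blast
    then have "eventually (\<lambda>(\<Phi>, \<Phi>'). Hom K \<Phi> \<Phi>' ?u < \<epsilon>) (F \<times>\<^sub>F F)"
      using cauchy by (simp add: le_filter_def)
    then obtain Q where Q: "eventually Q F" "\<And>\<Phi> \<Phi>'. Q \<Phi> \<Longrightarrow> Q \<Phi>' \<Longrightarrow> Hom K \<Phi> \<Phi>' ?u < \<epsilon>"
      unfolding eventually_prod_same by auto
    have close: "\<Phi>' a (?u + s) \<le> S \<epsilon> (\<Phi> a s)"
      if "Q \<Phi>" "weight \<Phi>" "Q \<Phi>'" "weight \<Phi>'" "a \<in> Ob C" "s > 0" for \<Phi> \<Phi>' a s
      using Q(2)[OF that(1,3)] Hom_K_le_iff[OF that(2,4) u2 \<epsilon>I] that by simp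
    from Q(1) weights show ?thesis
    proof eventually_elim
      case (elim \<Phi>)
      have "\<Psi> a (u + s) \<le> S \<epsilon> (\<Phi> a s) \<and> \<Phi> a (u + s) \<le> S \<epsilon> (\<Psi> a s)"
        if a: "a \<in> Ob C" and s: "s > 0" for a s
      proof
        have \<Phi>_in: "\<Phi> a s \<in> I" using weight_in elim(2) a s by blast
        have "\<Psi> a (u + s) \<le> \<Psi> a (?u + s)"
          by (rule W_antimono[OF \<Psi>_W[OF a]]) (use u s in auto)
        also have "\<dots> \<le> G a (?u + s)" by (rule \<Psi>_le) (use a s u in auto)
        also have "\<dots> \<le> S \<epsilon> (\<Phi> a s)"
        proof (rule G_le[OF S_in[OF \<epsilon>I \<Phi>_in]])
          from Q(1) weights show "eventually (\<lambda>\<Phi>'. \<Phi>' a (?u + s) \<le> S \<epsilon> (\<Phi> a s)) F"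
            by eventually_elim (use close elim a s in blast)
        qed
        finally show "\<Psi> a (u + s) \<le> S \<epsilon> (\<Phi> a s)" .
        have us: "?u + s > 0" "u + s > 0" using u s by simp_all
        have G01: "G a (?u + s) \<in> I" by (rule G_in[OF a us(1)])
        have \<Psi>01: "\<Psi> a s \<in> I" by (rule W_in[OF \<Psi>_W[OF a] s])
        \<comment> \<open>\<open>S_le_limit\<close> varies the first argument, hence the swapped
          order. One half of \<open>u\<close> pays for the Cauchy estimate, the other for the
          regularization.\<close>
        have "\<Phi> a (u + s) \<le> S (G a (?u + s)) \<epsilon>"
        proof (rule S_le_limit[OF \<epsilon>I G01])
          show "\<Phi> a (u + s) \<le> 1" using weight_in[OF elim(2) a us(2)] by simp
          fix c :: real assume c: "G a (?u + s) < c" "c \<le> 1"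
          have "eventually (\<lambda>\<Phi>'. Q \<Phi>' \<and> weight \<Phi>' \<and> \<Phi>' a (?u + s) \<le> c) F"
            by (intro eventually_conj Q(1) weights G_less[OF a us(1) c(1)])
          then obtain \<Phi>' where \<Phi>': "Q \<Phi>'" "weight \<Phi>'" "\<Phi>' a (?u + s) \<le> c"
            using eventually_happens'[OF F(1)] by blast
          have "\<Phi> a (?u + (?u + s)) \<le> S \<epsilon> (\<Phi>' a (?u + s))"
            by (rule close) (use elim \<Phi>' a us in auto)
          also have "?u + (?u + s) = u + s" by simp
          also have "S \<epsilon> (\<Phi>' a (?u + s)) \<le> S \<epsilon> c"
            by (rule S_mono) (use \<Phi>' c G01 \<epsilon>I weight_in[OF \<Phi>'(2) a us(1)] in auto)
          also have "\<dots> = S c \<epsilon>" by (rule S_comm) (use \<epsilon>I c G01 in auto)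
          finally show "\<Phi> a (u + s) \<le> S c \<epsilon>" .
        qed
        also have "\<dots> \<le> S (\<Psi> a s) \<epsilon>"
          by (rule S_mono[OF G01 \<epsilon>I \<Psi>01 \<epsilon>I le_\<Psi>]) (use a s u in auto)
        also have "\<dots> = S \<epsilon> (\<Psi> a s)" by (rule S_comm[OF \<Psi>01 \<epsilon>I])
        finally show "\<Phi> a (u + s) \<le> S \<epsilon> (\<Psi> a s)" .
      qed
      with elim(2) show ?case by blast
    qed
  qed
  moreover have "\<Psi> \<in> Ob C \<rightarrow>\<^sub>E W" using \<Psi>_W by (auto simp: \<Psi>_def)
  ultimately show thesis using that by blast
qed

text \<open>The module and counit clauses pass from an approximant \<Phi> to \<Psi> at the cost of
  two \<epsilon> and two delays \<open>u / 2\<close>, which \<open>W_le_limit\<close> absorbs. The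
  unit clause needs one comparison at a point where \<Phi> is small.\<close>

lemma weight_closed:
  assumes \<Psi>: "\<Psi> \<in> Ob C \<rightarrow>\<^sub>E W"
    and approx: "\<And>\<epsilon> u. \<lbrakk>0 < \<epsilon>; \<epsilon> < 1; 0 < u\<rbrakk> \<Longrightarrow> \<exists>\<Phi>. weight \<Phi> \<and> (\<forall>a\<in>Ob C. \<forall>s>0.
       \<Psi> a (u + s) \<le> S \<epsilon> (\<Phi> a s) \<and> \<Phi> a (u + s) \<le> S \<epsilon> (\<Psi> a s))"
  shows "weight \<Psi>"
proof -
  have \<Psi>_W: "\<Psi> x \<in> W" if "x \<in> Ob C" for x using \<Psi> that by auto
  note \<Psi>_in = W_in[OF \<Psi>_W]
  have module: "\<Psi> x (t + s) \<le> S (d x y t) (\<Psi> y s)"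
    if xy: "x \<in> Ob C" "y \<in> Ob C" and ts: "t > 0" "s > 0" for x y t s
  proof (rule W_le_limit[OF \<Psi>_W[OF xy(1)] _ S_in[OF d_in[OF xy ts(1)] \<Psi>_in[OF xy(2) ts(2)]]])
    fix \<epsilon> u :: real assume \<epsilon>: "0 < \<epsilon>" "\<epsilon> < 1" and u: "0 < u"
    let ?u = "u / 2"
    have u2: "?u > 0" using u by simp
    obtain \<Phi> where \<Phi>: "weight \<Phi>"
      "\<And>a s. \<lbrakk>a \<in> Ob C; s > 0\<rbrakk> \<Longrightarrow> \<Psi> a (?u + s) \<le> S \<epsilon> (\<Phi> a s)"
      "\<And>a s. \<lbrakk>a \<in> Ob C; s > 0\<rbrakk> \<Longrightarrow> \<Phi> a (?u + s) \<le> S \<epsilon> (\<Psi> a s)"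
      using approx[OF \<epsilon> u2] by blast
    have pos: "?u + s > 0" "t + (?u + s) > 0" using ts u by simp_all
    have in01: "\<epsilon> \<in> I" "d x y t \<in> I" "\<Psi> y s \<in> I" "\<Phi> y (?u + s) \<in> I" "\<Phi> x (t + (?u + s)) \<in> I"
      using \<epsilon> d_in[OF xy ts(1)] \<Psi>_in[OF xy(2) ts(2)] weight_in[OF \<Phi>(1)] xy pos by auto
    have "\<Psi> x (?u + (t + (?u + s))) \<le> S \<epsilon> (\<Phi> x (t + (?u + s)))"
      by (rule \<Phi>(2)[OF xy(1) pos(2)])
    also have "\<dots> \<le> S \<epsilon> (S (d x y t) (\<Phi> y (?u + s)))"
      by (rule S_mono[OF in01(1,5,1) S_in[OF in01(2,4)] order_refl weight_module[OF \<Phi>(1) xy ts(1) pos(1)]])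
    also have "\<dots> \<le> S \<epsilon> (S (d x y t) (S \<epsilon> (\<Psi> y s)))"
      by (intro S_mono[OF in01(1) S_in[OF in01(2,4)] in01(1) S_in[OF in01(2) S_in[OF in01(1,3)]]]
          S_mono[OF in01(2,4,2) S_in[OF in01(1,3)]] \<Phi>(3)[OF xy(2) ts(2)] order_refl)
    also have "\<dots> = S (S \<epsilon> \<epsilon>) (S (d x y t) (\<Psi> y s))"
      using S_left_commute[OF in01(2,1,3)] S_assoc[OF in01(1,1) S_in[OF in01(2,3)]] by simp
    also have "?u + (t + (?u + s)) = t + s + u" by simp
    finally show "\<Psi> x (t + s + u) \<le> S (S \<epsilon> \<epsilon>) (S (d x y t) (\<Psi> y s))" .
  qed (use ts in simp)
  have counit: "d x y (t + s) \<le> S (\<Psi> x t) (\<Psi> y s)"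
    if xy: "x \<in> Ob C" "y \<in> Ob C" and ts: "t > 0" "s > 0" for x y t s
  proof (rule W_le_limit[OF d_W[OF xy] _ S_in[OF \<Psi>_in[OF xy(1) ts(1)] \<Psi>_in[OF xy(2) ts(2)]]])
    fix \<epsilon> u :: real assume \<epsilon>: "0 < \<epsilon>" "\<epsilon> < 1" and u: "0 < u"
    let ?u = "u / 2"
    have u2: "?u > 0" using u by simp
    obtain \<Phi> where \<Phi>: "weight \<Phi>"
      "\<And>a s. \<lbrakk>a \<in> Ob C; s > 0\<rbrakk> \<Longrightarrow> \<Phi> a (?u + s) \<le> S \<epsilon> (\<Psi> a s)"
      using approx[OF \<epsilon> u2] by blast
    have pos: "?u + t > 0" "?u + s > 0" using ts u by simp_all
    have in01: "\<epsilon> \<in> I" "\<Psi> x t \<in> I" "\<Psi> y s \<in> I" "\<Phi> x (?u + t) \<in> I" "\<Phi> y (?u + s) \<in> I"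
      using \<epsilon> \<Psi>_in[OF xy(1) ts(1)] \<Psi>_in[OF xy(2) ts(2)] weight_in[OF \<Phi>(1)] xy pos by auto
    have "d x y ((?u + t) + (?u + s)) \<le> S (\<Phi> x (?u + t)) (\<Phi> y (?u + s))"
      by (rule weight_counit[OF \<Phi>(1) xy pos])
    also have "\<dots> \<le> S (S \<epsilon> (\<Psi> x t)) (S \<epsilon> (\<Psi> y s))"
      by (rule S_mono[OF in01(4,5) S_in[OF in01(1,2)] S_in[OF in01(1,3)] \<Phi>(2)[OF xy(1) ts(1)] \<Phi>(2)[OF xy(2) ts(2)]])
    also have "\<dots> = S (S \<epsilon> \<epsilon>) (S (\<Psi> x t) (\<Psi> y s))"
      by (rule S_interchange[OF in01(1,2,1,3)])
    also have "(?u + t) + (?u + s) = t + s + u" by simp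
    finally show "d x y (t + s + u) \<le> S (S \<epsilon> \<epsilon>) (S (\<Psi> x t) (\<Psi> y s))" .
  qed (use ts in simp)
  have unit: "\<exists>x\<in>Ob C. \<Psi> x u < \<eta>" if \<eta>: "\<eta> > 0" and u: "u > 0" for \<eta> u
  proof -
    obtain \<epsilon> where \<epsilon>: "0 < \<epsilon>" "\<epsilon> < 1" "S \<epsilon> \<epsilon> < \<eta>" using S_small[OF \<eta>] by blast
    have u2: "u / 2 > 0" using u by simp
    obtain \<Phi> where \<Phi>: "weight \<Phi>"
      "\<And>a s. \<lbrakk>a \<in> Ob C; s > 0\<rbrakk> \<Longrightarrow> \<Psi> a (u / 2 + s) \<le> S \<epsilon> (\<Phi> a s)"
      using approx[OF \<epsilon>(1,2) u2] by blast
    obtain x where x: "x \<in> Ob C" "\<Phi> x (u / 2) < \<epsilon>" using weight_unit[OF \<Phi>(1) \<epsilon>(1) u2] by blast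
    have "\<Psi> x (u / 2 + u / 2) \<le> S \<epsilon> (\<Phi> x (u / 2))" by (rule \<Phi>(2)[OF x(1) u2])
    also have "\<dots> \<le> S \<epsilon> \<epsilon>"
      by (rule S_mono) (use \<epsilon> x weight_in[OF \<Phi>(1) x(1) u2] in auto)
    finally show ?thesis using x(1) \<epsilon>(3) by (intro bexI[of _ x]) auto
  qed
  show ?thesis
    unfolding weight_def by (intro conjI ballI allI impI \<Psi> module counit unit)
qed

lemma complete_K: "complete_uniformity (Ob K) (wcat_uniformity K)"
  unfolding complete_uniformity_def
proof (intro allI impI)
  fix F :: "('a \<Rightarrow> real \<Rightarrow> real) filter"
  assume F: "F \<noteq> bot" "F \<le> principal (Ob K)" "F \<times>\<^sub>F F \<le> wcat_uniformity K"
  obtain \<Psi> where \<Psi>: "\<Psi> \<in> Ob C \<rightarrow>\<^sub>E W"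
    and approx: "\<And>\<epsilon> u. \<lbrakk>0 < \<epsilon>; \<epsilon> < 1; 0 < u\<rbrakk> \<Longrightarrow> eventually (\<lambda>\<Phi>. weight \<Phi> \<and> (\<forall>a\<in>Ob C. \<forall>s>0.
       \<Psi> a (u + s) \<le> S \<epsilon> (\<Phi> a s) \<and> \<Phi> a (u + s) \<le> S \<epsilon> (\<Psi> a s))) F"
    using weight_limit[OF F] by blast
  have weight: "weight \<Psi>"
    by (rule weight_closed[OF \<Psi> eventually_happens'[OF F(1) approx]])
  have "filterlim (Pair \<Psi>) (wcat_uniformity K) F"
    unfolding filterlim_iff
  proof (intro allI impI)
    fix E assume "eventually E (wcat_uniformity K)"
    then obtain r t where r: "0 < r" "r < 1" and t: "0 < t"
      and E: "\<And>\<Phi> \<Phi>'. \<lbrakk>weight \<Phi>; weight \<Phi>'; Hom K \<Phi> \<Phi>' t < r; Hom K \<Phi>' \<Phi> t < r\<rbrakk> \<Longrightarrow> E (\<Phi>, \<Phi>')"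
      unfolding eventually_wcat_uniformity[OF wcategory_K] Ball_def Ob_K by blast
    \<comment> \<open>Halving \<open>r\<close> leaves room, as \<open>Hom_K_le_iff\<close> gives
      only weak inequalities while entourages require strict ones.\<close>
    have "0 < r / 2" "r / 2 < 1" "r / 2 \<in> I" using r by auto
    from approx[OF this(1,2) t] show "eventually (\<lambda>\<Phi>. E (\<Psi>, \<Phi>)) F"
    proof eventually_elim
      case (elim \<Phi>)
      then have "Hom K \<Psi> \<Phi> t \<le> r / 2" "Hom K \<Phi> \<Psi> t \<le> r / 2"
        using Hom_K_le_iff[OF _ _ t \<open>r / 2 \<in> I\<close>] weight by blast+
      then show ?case using E weight elim r by simp
    qed
  qed
  with weight show "\<exists>y\<in>Ob K. filterlim (Pair y) (wcat_uniformity K) F" using Ob_K by blast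
qed

section \<open>The Yoneda embedding and its density\<close>

lemma weight_yoneda:
  assumes a: "a \<in> Ob C"
  shows "weight (yoneda C a)"
  unfolding weight_def
proof (intro conjI ballI allI impI)
  show "yoneda C a \<in> Ob C \<rightarrow>\<^sub>E W" using a by (auto simp: yoneda_def intro: d_W)
  fix x y and t s :: real
  assume xy: "x \<in> Ob C" "y \<in> Ob C" and ts: "0 < t" "0 < s"
  \<comment> \<open>This clause is the triangle inequality through \<open>y\<close>; the next one is
    the triangle inequality through \<open>a\<close>, combined with symmetry.\<close>
  show "yoneda C a x (t + s) \<le> S (d x y t) (yoneda C a y s)"
    using d_triangle[OF xy a ts] xy by (simp add: yoneda_def)
  show "d x y (t + s) \<le> S (yoneda C a x t) (yoneda C a y s)"
    using d_triangle[OF xy(1) a xy(2) ts] xy d_sym[OF a xy(2)] by (simp add: yoneda_def)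
next
  fix \<epsilon> u :: real assume "0 < \<epsilon>" "0 < u"
  then show "\<exists>x\<in>Ob C. yoneda C a x u < \<epsilon>"
    using a d_refl by (auto simp: yoneda_def intro!: bexI[of _ a])
qed

text \<open>The Yoneda lemma. The upper bound is the module action; the lower bound comes from
  evaluation at \<open>a\<close>, where the representable vanishes, followed by removal of the
  delay.\<close>

lemma Hom_yoneda_left:
  assumes a: "a \<in> Ob C" and \<Phi>: "weight \<Phi>" and t: "t > 0"
  shows "Hom K (yoneda C a) \<Phi> t = \<Phi> a t"
proof (rule antisym)
  show "Hom K (yoneda C a) \<Phi> t \<le> \<Phi> a t"
    unfolding Hom_K_le_iff[OF weight_yoneda[OF a] \<Phi> t weight_in[OF \<Phi> a t]]
  proof (intro ballI allI impI)
    fix b and s :: real assume b: "b \<in> Ob C" and s: "0 < s"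
    show "\<Phi> b (t + s) \<le> S (\<Phi> a t) (yoneda C a b s)"
      using weight_module[OF \<Phi> b a s t] S_comm[OF weight_in[OF \<Phi> a t] d_in[OF b a s]] b
      by (simp add: yoneda_def add.commute)
  qed
  show "\<Phi> a t \<le> Hom K (yoneda C a) \<Phi> t"
  proof (rule W_right_limit_le[OF weight_W[OF \<Phi> a] t])
    fix u :: real assume u: "u > 0"
    have "\<Phi> a (t + u) \<le> S (Hom K (yoneda C a) \<Phi> t) (yoneda C a a u)"
      by (rule Hom_K_le[OF weight_yoneda[OF a] \<Phi> a t u])
    then show "\<Phi> a (t + u) \<le> Hom K (yoneda C a) \<Phi> t"
      using S_0_right[OF Hom_K_in[OF weight_yoneda[OF a] \<Phi> t]] a u by (simp add: yoneda_def d_refl)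
  qed
qed

text \<open>This is the counit clause of \<Phi>. The inequality is what density uses for the reverse
  hom-object.\<close>

lemma Hom_yoneda_right_le:
  assumes a: "a \<in> Ob C" and \<Phi>: "weight \<Phi>" and t: "t > 0"
  shows "Hom K \<Phi> (yoneda C a) t \<le> \<Phi> a t"
  unfolding Hom_K_le_iff[OF \<Phi> weight_yoneda[OF a] t weight_in[OF \<Phi> a t]]
proof (intro ballI allI impI)
  fix b and s :: real assume b: "b \<in> Ob C" and s: "0 < s"
  show "yoneda C a b (t + s) \<le> S (\<Phi> a t) (\<Phi> b s)"
    using weight_counit[OF \<Phi> a b t s] d_sym[OF a b] b by (simp add: yoneda_def)
qed

text \<open>The unit clause provides \<open>a\<close> with \<open>\<Phi> a t < r\<close>, and this
  value bounds the hom-objects between \<Phi> and the representable of \<open>a\<close> in both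
  directions.\<close>

lemma dense_yoneda: "dense_image (Ob C) (Ob K) (wcat_uniformity K) (yoneda C)"
  unfolding dense_image_def
proof (intro ballI allI impI)
  fix \<Phi> E assume "\<Phi> \<in> Ob K" and "eventually E (wcat_uniformity K)"
  then obtain r t where r: "0 < r" "r < 1" and t: "0 < t" and \<Phi>: "weight \<Phi>"
    and E: "\<And>\<Phi> \<Phi>'. \<lbrakk>weight \<Phi>; weight \<Phi>'; Hom K \<Phi> \<Phi>' t < r; Hom K \<Phi>' \<Phi> t < r\<rbrakk> \<Longrightarrow> E (\<Phi>, \<Phi>')"
    unfolding eventually_wcat_uniformity[OF wcategory_K] Ball_def Ob_K by blast
  obtain a where a: "a \<in> Ob C" "\<Phi> a t < r" using weight_unit[OF \<Phi> r(1) t] by blast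
  have "E (\<Phi>, yoneda C a)"
    using E[OF \<Phi> weight_yoneda[OF a(1)]] Hom_yoneda_left[OF a(1) \<Phi> t]
      Hom_yoneda_right_le[OF a(1) \<Phi> t] a(2) by simp
  with a(1) show "\<exists>y\<in>Ob C. E (\<Phi>, yoneda C y)" by blast
qed

lemma uniform_embedding_yoneda:
  assumes separated: "\<And>x y. \<lbrakk>x \<in> Ob C; y \<in> Ob C; \<And>t. t > 0 \<Longrightarrow> d x y t = 0\<rbrakk> \<Longrightarrow> x = y"
  shows "uniform_embedding (Ob C) (wcat_uniformity C) (Ob K) (wcat_uniformity K) (yoneda C)"
proof (rule uniform_embeddingI)
  have Hom: "Hom K (yoneda C x) (yoneda C y) t = d x y t" if "x \<in> Ob C" "y \<in> Ob C" "t > 0" for x y t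
    using Hom_yoneda_left[OF that(1) weight_yoneda[OF that(2)] that(3)] that by (simp add: yoneda_def)
  show "wcat_uniformity C \<le> principal (Ob C \<times> Ob C)"
    using uniformity_carrier_wcat_uniformity[OF wcat] by (simp add: uniformity_carrier_def)
  show "yoneda C \<in> Ob C \<rightarrow> Ob K" using weight_yoneda Ob_K by blast
  show "inj_on (yoneda C) (Ob C)"
  proof (rule inj_onI)
    fix x y assume xy: "x \<in> Ob C" "y \<in> Ob C" and eq: "yoneda C x = yoneda C y"
    show "x = y"
    proof (rule separated[OF xy])
      fix t :: real assume "t > 0"
      \<comment> \<open>Evaluating the two equal representables at \<open>x\<close> compares
        \<open>d x y\<close> with the vanishing \<open>d x x\<close>.\<close>
      moreover have "d x y = d x x" using fun_cong[OF eq, of x] xy by (simp add: yoneda_def)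
      ultimately show "d x y t = 0" using d_refl xy by simp
    qed
  qed
  show "eventually (\<lambda>(x, y). E (yoneda C x, yoneda C y)) (wcat_uniformity C)"
    if "eventually E (wcat_uniformity K)" for E
  proof -
    from that obtain r t where "0 < r" "r < 1" "0 < t"
      and E: "\<And>\<Phi> \<Phi>'. \<lbrakk>weight \<Phi>; weight \<Phi>'; Hom K \<Phi> \<Phi>' t < r; Hom K \<Phi>' \<Phi> t < r\<rbrakk> \<Longrightarrow> E (\<Phi>, \<Phi>')"
      unfolding eventually_wcat_uniformity[OF wcategory_K] Ball_def Ob_K by blast
    then show ?thesis
      unfolding eventually_wcat_uniformity[OF wcat] using Hom weight_yoneda
      by (intro exI[of _ r] exI[of _ t]) simp
  qed
  show "\<exists>D. eventually D (wcat_uniformity K) \<and>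
      (\<forall>x\<in>Ob C. \<forall>y\<in>Ob C. D (yoneda C x, yoneda C y) \<longrightarrow> E (x, y))"
    if "eventually E (wcat_uniformity C)" for E
  proof -
    from that obtain r t where rt: "0 < r" "r < 1" "0 < t"
      and E: "\<forall>x\<in>Ob C. \<forall>y\<in>Ob C. d x y t < r \<longrightarrow> d y x t < r \<longrightarrow> E (x, y)"
      unfolding eventually_wcat_uniformity[OF wcat] by blast
    let ?D = "\<lambda>(\<Phi>, \<Psi>). Hom K \<Phi> \<Psi> t < r \<and> Hom K \<Psi> \<Phi> t < r"
    have "eventually ?D (wcat_uniformity K)"
      unfolding eventually_wcat_uniformity[OF wcategory_K] using rt by blast
    moreover have "\<forall>x\<in>Ob C. \<forall>y\<in>Ob C. ?D (yoneda C x, yoneda C y) \<longrightarrow> E (x, y)"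
      using E Hom rt(3) by simp
    ultimately show ?thesis by blast
  qed
qed

theorem uniform_completion_yoneda:
  assumes "\<And>x y. \<lbrakk>x \<in> Ob C; y \<in> Ob C; \<And>t. t > 0 \<Longrightarrow> d x y t = 0\<rbrakk> \<Longrightarrow> x = y"
  shows "uniform_completion (Ob C) (wcat_uniformity C) (Ob K) (wcat_uniformity K) (yoneda C)"
  unfolding uniform_completion_def
  using uniformity_carrier_wcat_uniformity[OF wcat] uniformity_carrier_wcat_uniformity[OF wcategory_K]
    separated_K complete_K uniform_embedding_yoneda[OF assms] dense_yoneda by blast

end

section \<open>The enriched category of a gauge\<close>

lemma gauge_in:
  assumes "quasi_modular_gauge S X w" "x \<in> X" "y \<in> X" "t > 0"
  shows "w x y t \<in> {0..1}"
proof -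
  have "\<forall>x\<in>X. \<forall>y\<in>X. \<forall>t>0. w x y t \<in> {0..<1}"
    using assms(1) unfolding quasi_modular_gauge_def by (elim conjE)
  then have "w x y t \<in> {0..<1}" using assms(2-4) by blast
  then show ?thesis by simp
qed

lemma gauge_eq_0_iff:
  assumes "quasi_modular_gauge S X w" "x \<in> X" "y \<in> X" "t > 0"
  shows "w x y t = 0 \<longleftrightarrow> x = y"
proof -
  have "\<forall>x\<in>X. \<forall>y\<in>X. \<forall>t>0. w x y t = 0 \<longleftrightarrow> x = y"
    using assms(1) unfolding quasi_modular_gauge_def by (elim conjE)
  then show ?thesis using assms(2-4) by blast
qed

lemma gauge_antimono:
  assumes "quasi_modular_gauge S X w" "x \<in> X" "y \<in> X" "0 < s" "s \<le> t"
  shows "w x y t \<le> w x y s"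
proof -
  have "\<forall>x\<in>X. \<forall>y\<in>X. continuous_on {0<..} (w x y) \<and> antimono_on {0<..} (w x y)"
    using assms(1) unfolding quasi_modular_gauge_def by (elim conjE)
  then have "antimono_on {0<..} (w x y)" using assms(2,3) by blast
  then show ?thesis by (rule monotone_onD) (use assms(4,5) in simp_all)
qed

text \<open>\<open>S\<close> dominates both arguments, which gives one refinement with the same
  \<open>r\<close> and \<open>t\<close>; for the other, the radius shrinks to \<epsilon> with
  \<open>S \<epsilon> \<epsilon> < r\<close> while \<open>t\<close> is kept.\<close>

lemma (in continuous_conorm) sym_uniformity_eq:
  assumes w: "quasi_modular_gauge S X w"
  shows "sym_uniformity X w = wcat_uniformity (gauge_wcat S X w)"
proof -
  note range = gauge_in[OF w] and anti = gauge_antimono[OF w]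
  have "eventually P (sym_uniformity X w) \<longleftrightarrow> eventually P (wcat_uniformity (gauge_wcat S X w))" for P
  proof -
    have "E_sym X w r t \<subseteq> E_sym X w r' t'" if "r \<le> r'" "0 < t" "t \<le> t'" for r r' t t'
      using anti[OF _ _ that(2,3)] that(1)
      by (fastforce simp: E_sym_def E_plus_def E_minus_def dest: le_less_trans)
    then have "eventually P (sym_uniformity X w) \<longleftrightarrow>
        (\<exists>r t. 0 < r \<and> r < 1 \<and> 0 < t \<and> (\<forall>p\<in>E_sym X w r t. P p))"
      unfolding sym_uniformity_def by (rule eventually_two_parameter_base)
    also have "\<dots> \<longleftrightarrow> (\<exists>r t. 0 < r \<and> r < 1 \<and> 0 < t \<and>
        (\<forall>x\<in>X. \<forall>y\<in>X. wsym S w x y t < r \<longrightarrow> wsym S w y x t < r \<longrightarrow> P (x, y)))"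
    proof (intro iffI; elim exE conjE)
      fix r t :: real assume r: "0 < r" "r < 1" and t: "0 < t" and P: "\<forall>p\<in>E_sym X w r t. P p"
      have "P (x, y)" if xy: "x \<in> X" "y \<in> X" "wsym S w x y t < r" for x y
      proof -
        have "w x y t < r" "w y x t < r"
          using xy(3) le_S_left[OF range[OF xy(1,2) t] range[OF xy(2,1) t]]
            le_S_right[OF range[OF xy(1,2) t] range[OF xy(2,1) t]] by (simp_all add: wsym_def)
        then show ?thesis using P xy by (simp add: E_sym_def E_plus_def E_minus_def)
      qed
      with r t show "\<exists>r t. 0 < r \<and> r < 1 \<and> 0 < t \<and>
        (\<forall>x\<in>X. \<forall>y\<in>X. wsym S w x y t < r \<longrightarrow> wsym S w y x t < r \<longrightarrow> P (x, y))" by blast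
    next
      fix r t :: real assume r: "0 < r" "r < 1" and t: "0 < t"
        and P: "\<forall>x\<in>X. \<forall>y\<in>X. wsym S w x y t < r \<longrightarrow> wsym S w y x t < r \<longrightarrow> P (x, y)"
      obtain \<epsilon> where \<epsilon>: "0 < \<epsilon>" "\<epsilon> < 1" "S \<epsilon> \<epsilon> < r" using S_small[OF r(1)] by blast
      have small: "wsym S w x y t < r"
        if xy: "x \<in> X" "y \<in> X" and less: "w x y t < \<epsilon>" "w y x t < \<epsilon>" for x y
      proof -
        have "wsym S w x y t \<le> S \<epsilon> \<epsilon>"
          unfolding wsym_def
          by (rule S_mono[OF range[OF xy t] range[OF xy(2,1) t]]) (use \<epsilon> less in auto)
        with \<epsilon>(3) show ?thesis by simp
      qed
      have "\<forall>p\<in>E_sym X w \<epsilon> t. P p"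
        using P small by (auto simp: E_sym_def E_plus_def E_minus_def)
      with \<epsilon>(1,2) t show "\<exists>r t. 0 < r \<and> r < 1 \<and> 0 < t \<and> (\<forall>p\<in>E_sym X w r t. P p)" by blast
    qed
    also have "\<dots> \<longleftrightarrow> eventually P (wcat_uniformity (gauge_wcat S X w))"
      unfolding eventually_wcat_uniformity[OF gauge_wcat_symmetric(1)[OF conorm w]]
      by (simp add: gauge_wcat_def cong: conj_cong)
    finally show ?thesis .
  qed
  then show ?thesis by (simp add: filter_eq_iff)
qed

theorem theorem4p2:
  fixes S :: "real \<Rightarrow> real \<Rightarrow> real"
    and X :: "'a set"
    and w :: "'a \<Rightarrow> 'a \<Rightarrow> real \<Rightarrow> real"
  assumes "X \<noteq> {}"
    and "continuous_tconorm S"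
    and "quasi_modular_gauge S X w"
  defines "C \<equiv> gauge_wcat S X w"
  defines "K \<equiv> cauchy_completion S C"
  shows "uniform_completion X (sym_uniformity X w) (Ob K) (wcat_uniformity K) (yoneda C) \<and>
    (\<forall>(Y :: 'b set) \<V> j. uniform_completion X (sym_uniformity X w) Y \<V> j \<longrightarrow>
       (\<exists>!h. h \<in> extensional (Ob K) \<and> bi_uniform_iso (Ob K) (wcat_uniformity K) Y \<V> h \<and>
             (\<forall>x\<in>X. h (yoneda C x) = j x)))"
proof -
  interpret symmetric_wcategory S C
    unfolding C_def by unfold_locales (use assms(2,3) gauge_wcat_symmetric in blast)+
  have "uniform_completion (Ob C) (wcat_uniformity C) (Ob K) (wcat_uniformity K) (yoneda C)"
    unfolding K_def
  proof (rule uniform_completion_yoneda)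
    fix x y assume "x \<in> Ob C" "y \<in> Ob C" and zero: "\<And>t. t > 0 \<Longrightarrow> Hom C x y t = 0"
    then have xy: "x \<in> X" "y \<in> X" by (simp_all add: C_def gauge_wcat_def)
    note w = gauge_in[OF assms(3) xy, of 1] gauge_in[OF assms(3) xy(2,1), of 1]
    \<comment> \<open>A single time is enough: \<open>S\<close> bounds its first argument, so
      \<open>w x y 1\<close> vanishes and the gauge axiom identifies the points.\<close>
    have "S (w x y 1) (w y x 1) = 0" using zero[of 1] by (simp add: C_def gauge_wcat_def wsym_def)
    then show "x = y"
      using le_S_left[of "w x y 1" "w y x 1"] w gauge_eq_0_iff[OF assms(3) xy, of 1] by simp
  qed
  moreover have "Ob C = X" by (simp add: C_def gauge_wcat_def)
  moreover have "wcat_uniformity C = sym_uniformity X w"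
    using sym_uniformity_eq[OF assms(3)] by (simp add: C_def)
  ultimately have "uniform_completion X (sym_uniformity X w) (Ob K) (wcat_uniformity K) (yoneda C)"
    by simp
  then show ?thesis by (intro conjI allI impI uniform_completion_unique)
qed

end
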